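(* Every free Gödel algebra (i.e., Gödel algebra free over a set) is a bi-Heyting algebra.
   Context: A Gödel algebra is a Heyting algebra with $(x\to y)\vee(y\to x)=1$. A bi-Heyting algebra is a Heyting algebra whose order dual is also a Heyting algebra. A Gödel algebra $G$ is free over a set $S$ via $q\colon S\to G$ if for every Gödel algebra $H$ and function $f\colon S\to H$ there is a unique Heyting homomorphism $g\colon G\to H$ with $g\circ q=f$. *)

theory Defs
  imports "HOL-Algebra.Lattice" "HOL-Library.FuncSet"
begin

text \<open>A Heyting algebra is a bounded lattice in which every set \<open>{x. a \<sqinter> x \<sqsubseteq> b}\<close> has a greatest
  element. Since this is a property of the order alone, it applies verbatim to the order dual
  \<^const>\<open>inv_gorder\<close>. The summand \<^locale>\<open>weak_bounded_lattice\<close> only contributes top and bottom;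
  the summand \<^locale>\<open>lattice\<close> forces the equality of the structure to be genuine equality.\<close>

locale heyting_algebra = lattice L + weak_bounded_lattice L for L :: "'a gorder" (structure) +
  assumes relative_pseudocomplement_exists:
    "\<lbrakk>a \<in> carrier L; b \<in> carrier L\<rbrakk> \<Longrightarrow> \<exists>c. greatest L c {x \<in> carrier L. a \<sqinter> x \<sqsubseteq> b}"

definition heyting_imp :: "'a gorder \<Rightarrow> 'a \<Rightarrow> 'a \<Rightarrow> 'a"
  where "heyting_imp L a b = (THE c. greatest L c {x \<in> carrier L. a \<sqinter>\<^bsub>L\<^esub> x \<sqsubseteq>\<^bsub>L\<^esub> b})"

lemma (in heyting_algebra) greatest_heyting_imp:
  assumes "a \<in> carrier L" "b \<in> carrier L"
  shows "greatest L (heyting_imp L a b) {x \<in> carrier L. a \<sqinter> x \<sqsubseteq> b}"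
  unfolding heyting_imp_def
proof (rule theI')
  show "\<exists>!c. greatest L c {x \<in> carrier L. a \<sqinter> x \<sqsubseteq> b}"
    using relative_pseudocomplement_exists[OF assms] greatest_unique by blast
qed

locale bi_heyting_algebra = heyting_algebra L for L :: "'a gorder" (structure) +
  assumes dual_heyting: "heyting_algebra (inv_gorder L)"

locale goedel_algebra = heyting_algebra L for L :: "'a gorder" (structure) +
  assumes prelinear:
    "\<lbrakk>x \<in> carrier L; y \<in> carrier L\<rbrakk> \<Longrightarrow> heyting_imp L x y \<squnion> heyting_imp L y x = \<top>"

definition heyting_hom :: "'a gorder \<Rightarrow> 'b gorder \<Rightarrow> ('a \<Rightarrow> 'b) \<Rightarrow> bool"
  where "heyting_hom G H g \<longleftrightarrow>
    g \<in> carrier G \<rightarrow> carrier H \<and>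
    g \<bottom>\<^bsub>G\<^esub> = \<bottom>\<^bsub>H\<^esub> \<and>
    g \<top>\<^bsub>G\<^esub> = \<top>\<^bsub>H\<^esub> \<and>
    (\<forall>x \<in> carrier G. \<forall>y \<in> carrier G.
      g (x \<sqinter>\<^bsub>G\<^esub> y) = g x \<sqinter>\<^bsub>H\<^esub> g y \<and>
      g (x \<squnion>\<^bsub>G\<^esub> y) = g x \<squnion>\<^bsub>H\<^esub> g y \<and>
      g (heyting_imp G x y) = heyting_imp H (g x) (g y))"

text \<open>HOL cannot quantify over types inside a formula, so the type in which the carriers of the
  test algebras \<open>H\<close> live is an explicit parameter \<open>TYPE('h)\<close>. An algebra that is free over \<open>S\<close>
  without restriction on \<open>H\<close> satisfies the predicate for every \<open>'h\<close>.
  Maps out of \<open>G\<close> are taken extensional (\<^const>\<open>undefined\<close> off the carrier) so that uniqueness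
  means uniqueness on \<open>carrier G\<close>.\<close>

definition free_goedel_algebra ::
    "'h itself \<Rightarrow> 'a gorder \<Rightarrow> 's set \<Rightarrow> ('s \<Rightarrow> 'a) \<Rightarrow> bool"
  where "free_goedel_algebra (_ :: 'h itself) G S q \<longleftrightarrow>
    goedel_algebra G \<and> q \<in> S \<rightarrow> carrier G \<and>
    (\<forall>(H :: 'h gorder) f. goedel_algebra H \<and> f \<in> S \<rightarrow> carrier H \<longrightarrow>
      (\<exists>!g. g \<in> extensional (carrier G) \<and> heyting_hom G H g \<and> (\<forall>s \<in> S. g (q s) = f s)))"

text \<open>The instance \<open>'h = 'a + nat\<close>, with \<open>'a\<close> the type of \<open>G\<close>, is large enough to lose nothing:
  testing against the two-element algebra makes \<open>q\<close> injective on \<open>S\<close>, so the true free Goedel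
  algebra over \<open>S\<close>, whose cardinality is at most \<open>max |S| \<aleph>\<^sub>0\<close>, has a copy in \<open>'a + nat\<close>, and so has
  \<open>G\<close>. The two are then isomorphic by the usual argument.\<close>

end

theory Submission
  imports Defs
begin

text \<open>A prime filter \<open>F\<close> of a Goedel algebra induces a total preorder \<open>x \<rightharpoonup> y \<in> F\<close>, whose quotient is a
  chain. An element of a free algebra depends on a finite set \<open>T\<close> of generators (together with \<open>\<bottom>\<close> and
  \<open>\<top>\<close>), and whether it belongs to \<open>F\<close> depends only on the preorder of \<open>F\<close> on \<open>T\<close>. There are finitely
  many such preorders. For each \<open>F\<close> an element \<open>J\<^sub>F\<close> of the subalgebra generated by \<open>T\<close> lies in exactly
  those \<open>F'\<close> whose preorder on \<open>T\<close> arises from that of \<open>F\<close> by merging an upper segment with the top.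
  The least \<open>c\<close> with \<open>a \<le> b \<squnion> c\<close> is the finite join of all \<open>J\<^sub>F\<close> with \<open>a \<in> F\<close> and \<open>b \<notin> F\<close>. For minimality
  one needs that \<open>a \<le> b \<squnion> d\<close> implies \<open>J\<^sub>F \<le> d\<close>, where \<open>d\<close> may involve further generators: if \<open>J\<^sub>F \<in> F'\<close>
  but \<open>d \<notin> F'\<close>, then freeness, applied to the chain of \<open>F'\<close> with its top replaced by a copy of the naturals,
  yields a prime filter below \<open>F'\<close> that induces on \<open>T\<close> the same preorder as \<open>F\<close>; it contains \<open>a\<close>, but
  neither \<open>b\<close> nor \<open>d\<close>.\<close>

section \<open>Operations of a Goedel algebra\<close>

text \<open>The operations of a structure are definite descriptions over its order. Here candidates
  \<open>m\<close>, \<open>j\<close>, \<open>i\<close> are given through their adjunction properties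
  instead, so that chains and tagged subalgebras are recognised as Goedel algebras by checking
  inequalities alone.\<close>

locale goedel_operations =
  fixes L :: "'a gorder" (structure) and b t :: 'a and m j i :: "'a \<Rightarrow> 'a \<Rightarrow> 'a"
  assumes eq: "(.=) = (=)"
    and refl: "x \<in> carrier L \<Longrightarrow> x \<sqsubseteq> x"
    and antisym: "\<lbrakk>x \<in> carrier L; y \<in> carrier L; x \<sqsubseteq> y; y \<sqsubseteq> x\<rbrakk> \<Longrightarrow> x = y"
    and trans: "\<lbrakk>x \<in> carrier L; y \<in> carrier L; z \<in> carrier L; x \<sqsubseteq> y; y \<sqsubseteq> z\<rbrakk> \<Longrightarrow> x \<sqsubseteq> z"
    and bot: "b \<in> carrier L" "x \<in> carrier L \<Longrightarrow> b \<sqsubseteq> x"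
    and top: "t \<in> carrier L" "x \<in> carrier L \<Longrightarrow> x \<sqsubseteq> t"
    and m: "\<lbrakk>x \<in> carrier L; y \<in> carrier L\<rbrakk> \<Longrightarrow> m x y \<in> carrier L"
      "\<lbrakk>x \<in> carrier L; y \<in> carrier L; z \<in> carrier L\<rbrakk> \<Longrightarrow> z \<sqsubseteq> m x y \<longleftrightarrow> z \<sqsubseteq> x \<and> z \<sqsubseteq> y"
    and j: "\<lbrakk>x \<in> carrier L; y \<in> carrier L\<rbrakk> \<Longrightarrow> j x y \<in> carrier L"
      "\<lbrakk>x \<in> carrier L; y \<in> carrier L; z \<in> carrier L\<rbrakk> \<Longrightarrow> j x y \<sqsubseteq> z \<longleftrightarrow> x \<sqsubseteq> z \<and> y \<sqsubseteq> z"
    and i: "\<lbrakk>x \<in> carrier L; y \<in> carrier L\<rbrakk> \<Longrightarrow> i x y \<in> carrier L"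
      "\<lbrakk>x \<in> carrier L; y \<in> carrier L; z \<in> carrier L\<rbrakk> \<Longrightarrow> z \<sqsubseteq> i x y \<longleftrightarrow> m x z \<sqsubseteq> y"
    and prelin: "\<lbrakk>x \<in> carrier L; y \<in> carrier L\<rbrakk> \<Longrightarrow> j (i x y) (i y x) = t"
begin

lemma goedel:
  shows "goedel_algebra L" "\<bottom> = b" "\<top> = t"
    and "\<And>x y. \<lbrakk>x \<in> carrier L; y \<in> carrier L\<rbrakk> \<Longrightarrow> x \<sqinter> y = m x y"
    and "\<And>x y. \<lbrakk>x \<in> carrier L; y \<in> carrier L\<rbrakk> \<Longrightarrow> x \<squnion> y = j x y"
    and "\<And>x y. \<lbrakk>x \<in> carrier L; y \<in> carrier L\<rbrakk> \<Longrightarrow> heyting_imp L x y = i x y"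
proof -
  interpret partial_order L
  proof
    show "x .= x" for x by (simp add: eq)
    show "y .= x" if "x .= y" for x y using that by (simp add: eq)
    show "x .= z" if "x .= y" "y .= z" for x y z using that by (simp add: eq)
    show "x \<sqsubseteq> x" if "x \<in> carrier L" for x using that by (rule refl)
    show "x .= y" if "x \<sqsubseteq> y" "y \<sqsubseteq> x" "x \<in> carrier L" "y \<in> carrier L" for x y
      using that antisym by (simp add: eq)
    show "x \<sqsubseteq> z" if "x \<sqsubseteq> y" "y \<sqsubseteq> z" "x \<in> carrier L" "y \<in> carrier L" "z \<in> carrier L" for x y z
      using that trans by blast
    show "x \<sqsubseteq> z \<longleftrightarrow> y \<sqsubseteq> w" if "x .= y" "z .= w" for x y z w
      using that by (simp add: eq)
  qed (rule eq)
  have gm: "greatest L (m x y) (Lower L {x, y})" if "x \<in> carrier L" "y \<in> carrier L" for x y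
    using that m refl m(2)[OF that m(1)[OF that]] by (auto simp: greatest_def Lower_def)
  have lj: "least L (j x y) (Upper L {x, y})" if "x \<in> carrier L" "y \<in> carrier L" for x y
    using that j refl j(2)[OF that j(1)[OF that]] by (auto simp: least_def Upper_def)
  interpret lattice L
    by standard (use gm lj in blast)+
  have meet: "x \<sqinter> y = m x y" if "x \<in> carrier L" "y \<in> carrier L" for x y
    using inf_of_two_greatest[OF that] gm[OF that] greatest_unique unfolding meet_def by blast
  have join: "x \<squnion> y = j x y" if "x \<in> carrier L" "y \<in> carrier L" for x y
    using sup_of_two_least[OF that] lj[OF that] least_unique unfolding join_def by blast
  have lb: "least L b (carrier L)"
    using bot by (auto simp: least_def)
  have gt: "greatest L t (carrier L)"
    using top by (auto simp: greatest_def)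
  interpret weak_bounded_lattice L
    by standard (use lb gt in blast)+
  have gi: "greatest L (i x y) {z \<in> carrier L. x \<sqinter> z \<sqsubseteq> y}"
    if "x \<in> carrier L" "y \<in> carrier L" for x y
    using that i refl i(2)[OF that i(1)[OF that]] by (auto simp: greatest_def meet)
  interpret heyting_algebra L
    by standard (use gi in blast)
  have imp: "heyting_imp L x y = i x y" if "x \<in> carrier L" "y \<in> carrier L" for x y
    using greatest_heyting_imp[OF that] gi[OF that] greatest_unique by blast
  have tt: "\<top> = t"
    using top_greatest gt greatest_unique by blast
  show "goedel_algebra L"
    by standard (simp add: imp join i prelin tt)
  show "\<bottom> = b" "\<top> = t"
    using bottom_least lb least_unique tt by blast+
  show "\<And>x y. \<lbrakk>x \<in> carrier L; y \<in> carrier L\<rbrakk> \<Longrightarrow> x \<sqinter> y = m x y"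
    "\<And>x y. \<lbrakk>x \<in> carrier L; y \<in> carrier L\<rbrakk> \<Longrightarrow> x \<squnion> y = j x y"
    "\<And>x y. \<lbrakk>x \<in> carrier L; y \<in> carrier L\<rbrakk> \<Longrightarrow> heyting_imp L x y = i x y"
    using meet join imp by blast+
qed

end

section \<open>Residuation, prime filters and the dual of a Heyting algebra\<close>

context heyting_algebra
begin

abbreviation imp (infixr \<open>\<rightharpoonup>\<close> 60)
  where "x \<rightharpoonup> y \<equiv> heyting_imp L x y"

lemma imp_closed [simp]: "\<lbrakk>x \<in> carrier L; y \<in> carrier L\<rbrakk> \<Longrightarrow> x \<rightharpoonup> y \<in> carrier L"
  using greatest_heyting_imp by (auto simp: greatest_def)

lemma le_meet_iff:
  assumes "x \<in> carrier L" "y \<in> carrier L" "z \<in> carrier L"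
  shows "z \<sqsubseteq> x \<sqinter> y \<longleftrightarrow> z \<sqsubseteq> x \<and> z \<sqsubseteq> y"
  using assms meet_le[of z x y] meet_left[of x y] meet_right[of x y] meet_closed le_trans by blast

lemma join_le_iff:
  assumes "x \<in> carrier L" "y \<in> carrier L" "z \<in> carrier L"
  shows "x \<squnion> y \<sqsubseteq> z \<longleftrightarrow> x \<sqsubseteq> z \<and> y \<sqsubseteq> z"
  using assms join_le[of x z y] join_left[of x y] join_right[of x y] join_closed le_trans by blast

lemma meet_mono:
  assumes "x \<sqsubseteq> x'" "y \<sqsubseteq> y'" "x \<in> carrier L" "y \<in> carrier L" "x' \<in> carrier L" "y' \<in> carrier L"
  shows "x \<sqinter> y \<sqsubseteq> x' \<sqinter> y'"
proof -
  have "x \<sqinter> y \<sqsubseteq> x'" "x \<sqinter> y \<sqsubseteq> y'"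
    using assms le_trans[OF meet_left[of x y] assms(1)] le_trans[OF meet_right[of x y] assms(2)] by auto
  then show ?thesis
    using assms by (simp add: le_meet_iff)
qed

lemma le_imp_iff:
  assumes "x \<in> carrier L" "y \<in> carrier L" "z \<in> carrier L"
  shows "z \<sqsubseteq> x \<rightharpoonup> y \<longleftrightarrow> x \<sqinter> z \<sqsubseteq> y"
proof
  assume "z \<sqsubseteq> x \<rightharpoonup> y"
  then have "x \<sqinter> z \<sqsubseteq> x \<sqinter> (x \<rightharpoonup> y)"
    using assms by (simp add: meet_mono)
  moreover have "x \<sqinter> (x \<rightharpoonup> y) \<sqsubseteq> y"
    using greatest_heyting_imp[OF assms(1,2)] by (auto simp: greatest_def)
  ultimately show "x \<sqinter> z \<sqsubseteq> y"
    using le_trans[of "x \<sqinter> z" "x \<sqinter> (x \<rightharpoonup> y)" y] assms by simp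
next
  assume "x \<sqinter> z \<sqsubseteq> y"
  then show "z \<sqsubseteq> x \<rightharpoonup> y"
    using greatest_heyting_imp[OF assms(1,2)] assms by (auto simp: greatest_def)
qed

lemma modus_ponens: "\<lbrakk>x \<in> carrier L; y \<in> carrier L\<rbrakk> \<Longrightarrow> x \<sqinter> (x \<rightharpoonup> y) \<sqsubseteq> y"
  using le_imp_iff[of x y "x \<rightharpoonup> y"] by simp

definition lattice_filter :: "'a set \<Rightarrow> bool"
  where "lattice_filter F \<longleftrightarrow> F \<subseteq> carrier L \<and> \<top> \<in> F \<and>
    (\<forall>x\<in>F. \<forall>y\<in>carrier L. x \<sqsubseteq> y \<longrightarrow> y \<in> F) \<and> (\<forall>x\<in>F. \<forall>y\<in>F. x \<sqinter> y \<in> F)"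

definition prime_filter :: "'a set \<Rightarrow> bool"
  where "prime_filter F \<longleftrightarrow> lattice_filter F \<and> \<bottom> \<notin> F \<and>
    (\<forall>x\<in>carrier L. \<forall>y\<in>carrier L. x \<squnion> y \<in> F \<longrightarrow> x \<in> F \<or> y \<in> F)"

text \<open>This is the filter generated by \<open>F\<close> and \<open>x\<close>. If
  \<open>f\<close> and \<open>g\<close> witness two members, then \<open>f \<sqinter> g\<close>
  witnesses their meet.\<close>

lemma lattice_filter_adjoin:
  assumes F: "lattice_filter F" and x: "x \<in> carrier L"
  shows "lattice_filter {z \<in> carrier L. \<exists>f\<in>F. f \<sqinter> x \<sqsubseteq> z}" (is "lattice_filter ?A")
    and "F \<subseteq> {z \<in> carrier L. \<exists>f\<in>F. f \<sqinter> x \<sqsubseteq> z}"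
    and "x \<in> {z \<in> carrier L. \<exists>f\<in>F. f \<sqinter> x \<sqsubseteq> z}"
proof -
  have sub: "F \<subseteq> carrier L" and top: "\<top> \<in> F" and meet: "\<And>f g. \<lbrakk>f \<in> F; g \<in> F\<rbrakk> \<Longrightarrow> f \<sqinter> g \<in> F"
    using F by (auto simp: lattice_filter_def)
  show FA: "F \<subseteq> ?A"
    using sub x meet_left by blast
  show "x \<in> ?A"
    using sub x top meet_right by blast
  have up: "w \<in> ?A" if zw: "z \<in> ?A" "w \<in> carrier L" "z \<sqsubseteq> w" for z w
  proof -
    obtain f where "f \<in> F" "f \<sqinter> x \<sqsubseteq> z" "z \<in> carrier L"
      using zw(1) by blast
    then have "f \<sqinter> x \<sqsubseteq> w"
      using le_trans[of "f \<sqinter> x" z w] zw sub x meet_closed by blast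
    then show ?thesis
      using \<open>f \<in> F\<close> zw by blast
  qed
  have mt: "z \<sqinter> w \<in> ?A" if zw: "z \<in> ?A" "w \<in> ?A" for z w
  proof -
    obtain f g where fg: "f \<in> F" "f \<sqinter> x \<sqsubseteq> z" "g \<in> F" "g \<sqinter> x \<sqsubseteq> w" "z \<in> carrier L" "w \<in> carrier L"
      using zw by blast
    have c: "f \<in> carrier L" "g \<in> carrier L"
      using fg sub by auto
    have "f \<sqinter> g \<sqinter> x \<sqsubseteq> f \<sqinter> x" "f \<sqinter> g \<sqinter> x \<sqsubseteq> g \<sqinter> x"
      using c x by (simp_all add: meet_mono meet_left meet_right)
    then have "f \<sqinter> g \<sqinter> x \<sqsubseteq> z" "f \<sqinter> g \<sqinter> x \<sqsubseteq> w"
      using le_trans[of "f \<sqinter> g \<sqinter> x" "f \<sqinter> x" z] le_trans[of "f \<sqinter> g \<sqinter> x" "g \<sqinter> x" w] fg c x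
      by simp_all
    then have "f \<sqinter> g \<sqinter> x \<sqsubseteq> z \<sqinter> w"
      using fg c x by (simp add: le_meet_iff)
    then show ?thesis
      using meet fg by auto
  qed
  show "lattice_filter ?A"
    unfolding lattice_filter_def using up mt FA top by blast
qed

text \<open>By Zorn's lemma there is a filter maximal among those that contain \<open>a\<close> and
  omit \<open>b\<close>. It is prime: if neither \<open>x\<close> nor \<open>y\<close> belonged to
  it, adjoining either one would produce \<open>b\<close>, and then \<open>x \<squnion> y\<close>
  would produce \<open>b\<close> as well.\<close>

lemma prime_filter_separates:
  assumes a: "a \<in> carrier L" and b: "b \<in> carrier L" and nle: "\<not> a \<sqsubseteq> b"
  obtains F where "prime_filter F" "a \<in> F" "b \<notin> F"
proof -
  let ?A = "{F. lattice_filter F \<and> a \<in> F \<and> b \<notin> F}"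
  have "{z \<in> carrier L. a \<sqsubseteq> z} \<in> ?A"
    using a b nle by (auto simp: lattice_filter_def le_meet_iff intro: le_trans)
  then have ne: "?A \<noteq> {}" by blast
  have ch: "\<Union>C \<in> ?A" if C: "C \<noteq> {}" "subset.chain ?A C" for C
  proof -
    have CA: "C \<subseteq> ?A" and lin: "\<And>X Y. \<lbrakk>X \<in> C; Y \<in> C\<rbrakk> \<Longrightarrow> X \<subseteq> Y \<or> Y \<subseteq> X"
      using C(2) by (auto simp: subset.chain_def)
    have lf: "lattice_filter X" if "X \<in> C" for X
      using CA that by auto
    have "x \<sqinter> y \<in> \<Union>C" if xy: "x \<in> \<Union>C" "y \<in> \<Union>C" for x y
    proof -
      obtain X where X: "X \<in> C" "x \<in> X" "y \<in> X"
        using xy lin by blast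
      then have "x \<sqinter> y \<in> X"
        using lf[OF X(1)] unfolding lattice_filter_def by blast
      then show ?thesis
        using X(1) by blast
    qed
    moreover have "\<Union>C \<subseteq> carrier L" "\<top> \<in> \<Union>C"
      using lf C(1) unfolding lattice_filter_def by blast+
    moreover have "\<forall>x\<in>\<Union>C. \<forall>y\<in>carrier L. x \<sqsubseteq> y \<longrightarrow> y \<in> \<Union>C"
      using lf unfolding lattice_filter_def by blast
    ultimately have "lattice_filter (\<Union>C)"
      by (simp add: lattice_filter_def)
    then show ?thesis
      using CA C(1) by blast
  qed
  obtain M where M: "lattice_filter M" "a \<in> M" "b \<notin> M"
    and max: "\<And>X. \<lbrakk>lattice_filter X; a \<in> X; b \<notin> X; M \<subseteq> X\<rbrakk> \<Longrightarrow> X = M"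
    using subset_Zorn_nonempty[OF ne ch] by auto
  have sub: "M \<subseteq> carrier L" and meet: "\<And>f g. \<lbrakk>f \<in> M; g \<in> M\<rbrakk> \<Longrightarrow> f \<sqinter> g \<in> M"
    and up: "\<And>x y. \<lbrakk>x \<in> M; y \<in> carrier L; x \<sqsubseteq> y\<rbrakk> \<Longrightarrow> y \<in> M"
    using M(1) by (auto simp: lattice_filter_def)
  have ext: "\<exists>f\<in>M. f \<sqinter> x \<sqsubseteq> b" if "x \<in> carrier L" "x \<notin> M" for x
    using lattice_filter_adjoin[OF M(1) that(1)] max M(2) that(2) b by blast
  have "x \<in> M \<or> y \<in> M" if xy: "x \<in> carrier L" "y \<in> carrier L" "x \<squnion> y \<in> M" for x y
  proof (rule ccontr)
    assume "\<not> (x \<in> M \<or> y \<in> M)"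
    then obtain f g where fg: "f \<in> M" "f \<sqinter> x \<sqsubseteq> b" "g \<in> M" "g \<sqinter> y \<sqsubseteq> b"
      using ext xy by meson
    then have c: "f \<in> carrier L" "g \<in> carrier L"
      using sub by auto
    have "f \<sqinter> g \<sqinter> x \<sqsubseteq> f \<sqinter> x" "f \<sqinter> g \<sqinter> y \<sqsubseteq> g \<sqinter> y"
      using c xy by (simp_all add: meet_mono meet_left meet_right)
    then have "f \<sqinter> g \<sqinter> x \<sqsubseteq> b" "f \<sqinter> g \<sqinter> y \<sqsubseteq> b"
      using le_trans[of "f \<sqinter> g \<sqinter> x" "f \<sqinter> x" b] le_trans[of "f \<sqinter> g \<sqinter> y" "g \<sqinter> y" b] fg c xy b
      by simp_all
    \<comment> \<open>Distributivity comes from residuation: \<open>x\<close> and \<open>y\<close>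
      both lie below \<open>f \<sqinter> g \<rightharpoonup> b\<close>, hence so does their
      join.\<close>
    then have "x \<squnion> y \<sqsubseteq> f \<sqinter> g \<rightharpoonup> b"
      using c xy b by (subst join_le_iff) (simp_all add: le_imp_iff)
    then have "f \<sqinter> g \<sqinter> (x \<squnion> y) \<sqsubseteq> b"
      using le_imp_iff[of "f \<sqinter> g" b "x \<squnion> y"] c xy b by simp
    then have "b \<in> M"
      using up[of "f \<sqinter> g \<sqinter> (x \<squnion> y)" b] meet fg xy b by simp
    then show False
      using M(3) by blast
  qed
  moreover have "\<bottom> \<notin> M"
    using up M(3) b bottom_lower by blast
  ultimately have "prime_filter M"
    using M(1) by (auto simp: prime_filter_def)
  then show thesis
    using that M by blast
qed

text \<open>The witness is the meet of \<open>A\<close>, described by the filters that contain it,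
  which is the form used to read off the conjuncts of a formula.\<close>

lemma filter_of_finite_set:
  assumes "finite A" "A \<subseteq> carrier L"
  shows "\<exists>m\<in>carrier L. \<forall>F. lattice_filter F \<longrightarrow> (m \<in> F \<longleftrightarrow> A \<subseteq> F)"
  using assms
proof induction
  case empty
  have "\<forall>F. lattice_filter F \<longrightarrow> (\<top> \<in> F \<longleftrightarrow> {} \<subseteq> F)"
    by (simp add: lattice_filter_def)
  then show ?case
    using top_closed by blast
next
  case (insert x A)
  then obtain m where m: "m \<in> carrier L" "\<forall>F. lattice_filter F \<longrightarrow> (m \<in> F \<longleftrightarrow> A \<subseteq> F)"
    by auto
  have x: "x \<in> carrier L"
    using insert by auto
  have "x \<sqinter> m \<in> F \<longleftrightarrow> insert x A \<subseteq> F" if F: "lattice_filter F" for F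
  proof -
    have "x \<sqinter> m \<in> F \<longleftrightarrow> x \<in> F \<and> m \<in> F"
      using F x m(1) meet_left[OF x m(1)] meet_right[OF x m(1)] unfolding lattice_filter_def by blast
    then show ?thesis
      using m(2) F by auto
  qed
  then show ?case
    using m(1) x meet_closed by blast
qed

lemma finite_join_exists:
  assumes "finite A" "A \<subseteq> carrier L"
  shows "\<exists>s\<in>carrier L. \<forall>z\<in>carrier L. s \<sqsubseteq> z \<longleftrightarrow> (\<forall>x\<in>A. x \<sqsubseteq> z)"
  using assms
proof induction
  case empty
  then show ?case
    using bottom_closed bottom_lower by blast
next
  case (insert x A)
  then obtain s where s: "s \<in> carrier L" "\<forall>z\<in>carrier L. s \<sqsubseteq> z \<longleftrightarrow> (\<forall>x\<in>A. x \<sqsubseteq> z)"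
    by auto
  have "x \<in> carrier L"
    using insert by auto
  then show ?case
    using s by (intro bexI[of _ "x \<squnion> s"]) (auto simp: join_le_iff)
qed

text \<open>Reversing the order turns meets into joins and greatest elements into least ones, so the
  relative pseudocomplements of the dual are differences.\<close>

lemma dual_heyting_algebraI:
  assumes "\<And>a b. \<lbrakk>a \<in> carrier L; b \<in> carrier L\<rbrakk> \<Longrightarrow> \<exists>c. least L c {d \<in> carrier L. a \<sqsubseteq> b \<squnion> d}"
  shows "heyting_algebra (inv_gorder L)"
proof -
  interpret dual: lattice "inv_gorder L"
    by (rule dual_lattice)
  have "\<exists>x. least (inv_gorder L) x (carrier (inv_gorder L))"
    "\<exists>x. greatest (inv_gorder L) x (carrier (inv_gorder L))"
    using top_greatest bottom_least by auto
  then interpret dual: weak_bounded_lattice "inv_gorder L"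
    by unfold_locales
  show ?thesis
    by unfold_locales (use assms in auto)
qed

end

section \<open>The chain of a prime filter\<close>

context goedel_algebra
begin

context
  fixes F
  assumes F: "prime_filter F"
begin

lemma prime_filter_closed: "x \<in> F \<Longrightarrow> x \<in> carrier L"
  using F by (auto simp: prime_filter_def lattice_filter_def)

lemma prime_filter_top: "\<top> \<in> F"
  using F by (auto simp: prime_filter_def lattice_filter_def)

lemma prime_filter_bottom: "\<bottom> \<notin> F"
  using F by (auto simp: prime_filter_def)

lemma prime_filter_upward: "\<lbrakk>x \<in> F; x \<sqsubseteq> y; y \<in> carrier L\<rbrakk> \<Longrightarrow> y \<in> F"
  using F by (auto simp: prime_filter_def lattice_filter_def)

lemma prime_filter_meet_iff:
  assumes "x \<in> carrier L" "y \<in> carrier L"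
  shows "x \<sqinter> y \<in> F \<longleftrightarrow> x \<in> F \<and> y \<in> F"
proof
  assume "x \<sqinter> y \<in> F"
  then show "x \<in> F \<and> y \<in> F"
    using prime_filter_upward meet_left meet_right assms by blast
next
  assume "x \<in> F \<and> y \<in> F"
  then show "x \<sqinter> y \<in> F"
    using F by (auto simp: prime_filter_def lattice_filter_def)
qed

lemma prime_filter_join_iff:
  assumes "x \<in> carrier L" "y \<in> carrier L"
  shows "x \<squnion> y \<in> F \<longleftrightarrow> x \<in> F \<or> y \<in> F"
proof
  assume "x \<squnion> y \<in> F"
  then show "x \<in> F \<or> y \<in> F"
    using F assms by (auto simp: prime_filter_def)
next
  assume "x \<in> F \<or> y \<in> F"
  then show "x \<squnion> y \<in> F"
    using prime_filter_upward join_left join_right join_closed assms by blast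
qed

lemma prime_filter_imp_le: "\<lbrakk>x \<in> carrier L; y \<in> carrier L; x \<sqsubseteq> y\<rbrakk> \<Longrightarrow> x \<rightharpoonup> y \<in> F"
  by (rule prime_filter_upward[OF prime_filter_top])
    (auto simp: le_imp_iff intro: le_trans[OF meet_left])

lemma prime_filter_imp_refl: "x \<in> carrier L \<Longrightarrow> x \<rightharpoonup> x \<in> F"
  by (simp add: prime_filter_imp_le)

lemma prime_filter_mp:
  assumes "x \<rightharpoonup> y \<in> F" "x \<in> F" "y \<in> carrier L"
  shows "y \<in> F"
proof -
  have "x \<in> carrier L"
    using assms prime_filter_closed by blast
  then have "x \<sqinter> (x \<rightharpoonup> y) \<in> F"
    using assms by (simp add: prime_filter_meet_iff)
  then show ?thesis
    using prime_filter_upward modus_ponens \<open>x \<in> carrier L\<close> assms(3) by blast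
qed

lemma prime_filter_imp_right: "\<lbrakk>x \<in> carrier L; y \<in> F\<rbrakk> \<Longrightarrow> x \<rightharpoonup> y \<in> F"
  using prime_filter_upward[of y "x \<rightharpoonup> y"] prime_filter_closed[of y]
  by (simp add: le_imp_iff meet_right)

lemma prime_filter_imp_trans:
  assumes "x \<rightharpoonup> y \<in> F" "y \<rightharpoonup> z \<in> F" "x \<in> carrier L" "y \<in> carrier L" "z \<in> carrier L"
  shows "x \<rightharpoonup> z \<in> F"
proof -
  let ?p = "x \<rightharpoonup> y" and ?q = "y \<rightharpoonup> z"
  have c: "?p \<in> carrier L" "?q \<in> carrier L"
    using assms by simp_all
  have "x \<sqinter> (?p \<sqinter> ?q) \<sqsubseteq> x \<sqinter> ?p"
    using assms c by (simp add: meet_mono meet_left)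
  then have "x \<sqinter> (?p \<sqinter> ?q) \<sqsubseteq> y"
    using le_trans[of _ "x \<sqinter> ?p" y] modus_ponens[of x y] assms c by simp
  moreover have "x \<sqinter> (?p \<sqinter> ?q) \<sqsubseteq> ?q"
    using le_trans[OF meet_right meet_right] assms c by simp
  ultimately have "x \<sqinter> (?p \<sqinter> ?q) \<sqsubseteq> y \<sqinter> ?q"
    using assms c by (simp add: le_meet_iff)
  then have "x \<sqinter> (?p \<sqinter> ?q) \<sqsubseteq> z"
    using le_trans[of _ "y \<sqinter> ?q" z] modus_ponens[of y z] assms c by simp
  then have "?p \<sqinter> ?q \<sqsubseteq> x \<rightharpoonup> z"
    using assms c by (simp add: le_imp_iff)
  moreover have "?p \<sqinter> ?q \<in> F"
    using assms c by (simp add: prime_filter_meet_iff)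
  ultimately show ?thesis
    using prime_filter_upward assms by simp
qed

text \<open>Prelinearity puts the join of both implications into \<open>F\<close>, and primeness
  selects one of them. This is what makes the quotient modulo \<open>F\<close> a chain.\<close>

lemma prime_filter_imp_total: "\<lbrakk>x \<in> carrier L; y \<in> carrier L\<rbrakk> \<Longrightarrow> x \<rightharpoonup> y \<in> F \<or> y \<rightharpoonup> x \<in> F"
  using prelinear[of x y] prime_filter_top prime_filter_join_iff[of "x \<rightharpoonup> y" "y \<rightharpoonup> x"] by simp

end

text \<open>The Heyting congruence of the filter \<open>F\<close>. For prime \<open>F\<close> its
  quotient is a chain whose top class is \<open>F\<close> itself.\<close>

definition filter_equiv :: "'a set \<Rightarrow> 'a \<Rightarrow> 'a \<Rightarrow> bool"
  where "filter_equiv F x y \<longleftrightarrow> x \<rightharpoonup> y \<in> F \<and> y \<rightharpoonup> x \<in> F"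

lemma filter_equiv_sym: "filter_equiv F x y \<Longrightarrow> filter_equiv F y x"
  by (auto simp: filter_equiv_def)

context
  fixes F
  assumes F: "prime_filter F"
begin

lemma filter_equiv_refl: "x \<in> carrier L \<Longrightarrow> filter_equiv F x x"
  by (simp add: filter_equiv_def prime_filter_imp_refl[OF F])

lemma filter_equiv_trans:
  "\<lbrakk>filter_equiv F x y; filter_equiv F y z; x \<in> carrier L; y \<in> carrier L; z \<in> carrier L\<rbrakk>
    \<Longrightarrow> filter_equiv F x z"
  unfolding filter_equiv_def using prime_filter_imp_trans[OF F] by blast

lemma filter_equiv_imp_mem_iff:
  assumes "filter_equiv F x x'" "filter_equiv F y y'"
    and "x \<in> carrier L" "x' \<in> carrier L" "y \<in> carrier L" "y' \<in> carrier L"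
  shows "x \<rightharpoonup> y \<in> F \<longleftrightarrow> x' \<rightharpoonup> y' \<in> F"
proof
  assume "x \<rightharpoonup> y \<in> F"
  then have "x' \<rightharpoonup> y \<in> F"
    using assms prime_filter_imp_trans[OF F, of x' x y] by (auto simp: filter_equiv_def)
  then show "x' \<rightharpoonup> y' \<in> F"
    using assms prime_filter_imp_trans[OF F, of x' y y'] by (auto simp: filter_equiv_def)
next
  assume "x' \<rightharpoonup> y' \<in> F"
  then have "x \<rightharpoonup> y' \<in> F"
    using assms prime_filter_imp_trans[OF F, of x x' y'] by (auto simp: filter_equiv_def)
  then show "x \<rightharpoonup> y \<in> F"
    using assms prime_filter_imp_trans[OF F, of x y' y] by (auto simp: filter_equiv_def)
qed

lemma filter_equiv_mem_iff:
  "\<lbrakk>filter_equiv F x y; x \<in> carrier L; y \<in> carrier L\<rbrakk> \<Longrightarrow> x \<in> F \<longleftrightarrow> y \<in> F"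
  unfolding filter_equiv_def using prime_filter_mp[OF F] by blast

lemma filter_equiv_mem: "\<lbrakk>x \<in> F; y \<in> F\<rbrakk> \<Longrightarrow> filter_equiv F x y"
  unfolding filter_equiv_def
  using prime_filter_imp_right[OF F] prime_filter_closed[OF F] by blast

text \<open>Together with \<open>filter_equiv_join\<close> and \<open>filter_equiv_imp\<close> this
  computes the operations of the quotient modulo \<open>F\<close>: they are those of a chain, namely
  minimum, maximum, and the implication with value \<open>y\<close> where \<open>x\<close> is not
  below \<open>y\<close>.\<close>

lemma filter_equiv_meet:
  assumes "x \<rightharpoonup> y \<in> F" "x \<in> carrier L" "y \<in> carrier L"
  shows "filter_equiv F (x \<sqinter> y) x"
proof -
  have "x \<rightharpoonup> y \<sqsubseteq> x \<rightharpoonup> (x \<sqinter> y)"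
    using assms modus_ponens[of x y] by (simp add: le_imp_iff le_meet_iff meet_left)
  then have "x \<rightharpoonup> (x \<sqinter> y) \<in> F"
    using prime_filter_upward[OF F] assms by simp
  moreover have "x \<sqinter> y \<rightharpoonup> x \<in> F"
    using assms by (simp add: prime_filter_imp_le[OF F] meet_left)
  ultimately show ?thesis
    by (simp add: filter_equiv_def)
qed

lemma filter_equiv_join:
  assumes "x \<rightharpoonup> y \<in> F" "x \<in> carrier L" "y \<in> carrier L"
  shows "filter_equiv F (x \<squnion> y) y"
proof -
  let ?p = "x \<rightharpoonup> y"
  have "x \<sqsubseteq> ?p \<rightharpoonup> y"
    using assms modus_ponens[of x y] by (simp add: le_imp_iff meet_comm[of L "?p"])
  moreover have "y \<sqsubseteq> ?p \<rightharpoonup> y"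
    using assms by (simp add: le_imp_iff meet_right)
  ultimately have "x \<squnion> y \<sqsubseteq> ?p \<rightharpoonup> y"
    using assms by (simp add: join_le_iff)
  then have "?p \<sqsubseteq> x \<squnion> y \<rightharpoonup> y"
    using assms by (simp add: le_imp_iff meet_comm[of L "?p"])
  then have "x \<squnion> y \<rightharpoonup> y \<in> F"
    using prime_filter_upward[OF F] assms by simp
  moreover have "y \<rightharpoonup> x \<squnion> y \<in> F"
    using assms by (simp add: prime_filter_imp_le[OF F] join_right)
  ultimately show ?thesis
    by (simp add: filter_equiv_def)
qed

text \<open>Prelinearity enters through \<open>((x \<rightharpoonup> y) \<rightharpoonup> x) \<squnion> (x \<rightharpoonup> (x \<rightharpoonup> y)) = \<top>\<close>.\<close>

lemma filter_equiv_imp: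
  assumes "x \<rightharpoonup> y \<notin> F" "x \<in> carrier L" "y \<in> carrier L"
  shows "filter_equiv F (x \<rightharpoonup> y) y"
proof -
  let ?p = "x \<rightharpoonup> y"
  have c: "?p \<in> carrier L"
    using assms by simp
  have "x \<sqinter> (x \<rightharpoonup> ?p) \<sqsubseteq> x" "x \<sqinter> (x \<rightharpoonup> ?p) \<sqsubseteq> ?p"
    using assms c modus_ponens[of x ?p] by (simp_all add: meet_left)
  then have "x \<sqinter> (x \<rightharpoonup> ?p) \<sqsubseteq> x \<sqinter> ?p"
    using assms c by (simp add: le_meet_iff)
  then have "x \<sqinter> (x \<rightharpoonup> ?p) \<sqsubseteq> y"
    using le_trans[of _ "x \<sqinter> ?p" y] modus_ponens[of x y] assms c by simp
  \<comment> \<open>Contraction. It keeps \<open>x \<rightharpoonup> ?p\<close> out of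
    \<open>F\<close>, so totality places \<open>?p\<close> below \<open>x\<close> in the chain;
    there \<open>?p\<close> equals its meet with \<open>x\<close>, which lies below
    \<open>y\<close>.\<close>
  then have "x \<rightharpoonup> ?p \<sqsubseteq> ?p"
    using assms c by (simp add: le_imp_iff)
  then have "x \<rightharpoonup> ?p \<notin> F"
    using prime_filter_upward[OF F, of "x \<rightharpoonup> ?p" ?p] assms c by blast
  then have "?p \<rightharpoonup> x \<in> F"
    using prime_filter_imp_total[OF F, of ?p x] assms c by simp
  then have "filter_equiv F (?p \<sqinter> x) ?p"
    using filter_equiv_meet[of ?p x] assms c by simp
  moreover have "?p \<sqinter> x \<rightharpoonup> y \<in> F"
    using assms c modus_ponens[of x y] by (simp add: prime_filter_imp_le[OF F] meet_comm[of L ?p])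
  ultimately have "?p \<rightharpoonup> y \<in> F"
    unfolding filter_equiv_def using prime_filter_imp_trans[OF F, of ?p "?p \<sqinter> x" y] assms c by simp
  moreover have "y \<rightharpoonup> ?p \<in> F"
    using assms c by (simp add: prime_filter_imp_le[OF F] le_imp_iff meet_right)
  ultimately show ?thesis
    by (simp add: filter_equiv_def)
qed

text \<open>If \<open>x \<rightharpoonup> y\<close> is outside \<open>F\<close>, it is equivalent to
  \<open>y\<close>, so the left side holds; otherwise modus ponens decides. The lemma turns the
  second clause of \<open>collapses\<close> into membership of a single element, which makes
  collapsing expressible in the algebra.\<close>

lemma imp_imp_mem_iff:
  assumes "x \<in> carrier L" "y \<in> carrier L"
  shows "(x \<rightharpoonup> y) \<rightharpoonup> y \<in> F \<longleftrightarrow> (x \<rightharpoonup> y \<in> F \<longrightarrow> y \<in> F)"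
  using assms filter_equiv_imp[of x y] prime_filter_mp[OF F, of "x \<rightharpoonup> y" y]
    prime_filter_imp_right[OF F, of "x \<rightharpoonup> y" y]
  unfolding filter_equiv_def using imp_closed by blast

end

section \<open>Collapses of finite chains and the elements determined by them\<close>

text \<open>A prime filter linearly orders the classes of the elements of \<open>T\<close>. If \<open>collapses T F F'\<close>, then
  the order of \<open>F'\<close> arises from that of \<open>F\<close> by merging an upper segment with the class of \<open>\<top>\<close>.
  The predicate \<open>determined T\<close> is a substitute for membership in the subalgebra generated by \<open>T\<close>.\<close>

definition collapses :: "'a set \<Rightarrow> 'a set \<Rightarrow> 'a set \<Rightarrow> bool"
  where "collapses T F F' \<longleftrightarrow> (\<forall>x\<in>T. \<forall>y\<in>T.
    if x \<rightharpoonup> y \<in> F then x \<rightharpoonup> y \<in> F' else x \<rightharpoonup> y \<in> F' \<longrightarrow> y \<in> F')"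

definition determined :: "'a set \<Rightarrow> 'a \<Rightarrow> bool"
  where "determined T a \<longleftrightarrow> (\<forall>F F'. prime_filter F \<longrightarrow> prime_filter F' \<longrightarrow> collapses T F F' \<longrightarrow>
    (\<exists>t\<in>T. filter_equiv F a t \<and> filter_equiv F' a t))"

lemma collapses_refl: "collapses T F F"
  by (auto simp: collapses_def)

lemma collapses_imp:
  "\<lbrakk>collapses T F F'; x \<in> T; y \<in> T; x \<rightharpoonup> y \<in> F\<rbrakk> \<Longrightarrow> x \<rightharpoonup> y \<in> F'"
  unfolding collapses_def by meson

lemma collapses_imp_neg:
  "\<lbrakk>collapses T F F'; x \<in> T; y \<in> T; x \<rightharpoonup> y \<notin> F; x \<rightharpoonup> y \<in> F'\<rbrakk> \<Longrightarrow> y \<in> F'"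
  unfolding collapses_def by meson

text \<open>A larger \<open>T\<close> makes \<open>collapses\<close> a stronger hypothesis and
  offers more representatives.\<close>

lemma determined_mono: "\<lbrakk>determined T a; T \<subseteq> T'\<rbrakk> \<Longrightarrow> determined T' a"
  unfolding determined_def collapses_def by (meson subsetD)

lemma determined_self: "\<lbrakk>t \<in> T; T \<subseteq> carrier L\<rbrakk> \<Longrightarrow> determined T t"
  unfolding determined_def using filter_equiv_refl by blast

text \<open>One representative has to serve both filters. A collapse preserves
  \<open>\<rightharpoonup>\<close>-inequalities between members of \<open>T\<close>, so the smaller
  of the representatives \<open>s\<close> and \<open>t\<close> under \<open>F\<close> is also the
  smaller under \<open>F'\<close>. Joins are treated in the same way with the larger one.\<close>

lemma determined_meet:
  assumes a: "determined T a" "a \<in> carrier L" and b: "determined T b" "b \<in> carrier L"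
    and T: "T \<subseteq> carrier L"
  shows "determined T (a \<sqinter> b)"
  unfolding determined_def
proof (intro allI impI)
  fix F F'
  assume F: "prime_filter F" and F': "prime_filter F'" and col: "collapses T F F'"
  obtain s t where s: "s \<in> T" "filter_equiv F a s" "filter_equiv F' a s"
    and t: "t \<in> T" "filter_equiv F b t" "filter_equiv F' b t"
    using a b F F' col unfolding determined_def by meson
  have c: "s \<in> carrier L" "t \<in> carrier L"
    using s t T by auto
  have le: "filter_equiv P (x \<sqinter> y) u"
    if "prime_filter P" "u \<rightharpoonup> v \<in> P" "filter_equiv P x u" "filter_equiv P y v"
      "x \<in> carrier L" "y \<in> carrier L" "u \<in> carrier L" "v \<in> carrier L" for P x y u v
    using filter_equiv_meet[OF that(1), of x y] filter_equiv_trans[OF that(1), of "x \<sqinter> y" x u]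
      filter_equiv_imp_mem_iff[OF that(1,3,4)] that by simp
  show "\<exists>t\<in>T. filter_equiv F (a \<sqinter> b) t \<and> filter_equiv F' (a \<sqinter> b) t"
  proof (cases "s \<rightharpoonup> t \<in> F")
    case True
    then have "s \<rightharpoonup> t \<in> F'"
      using collapses_imp col s t by blast
    then show ?thesis
      using le[OF F True s(2) t(2)] le[OF F' _ s(3) t(3)] s(1) a b c by blast
  next
    case False
    then have "t \<rightharpoonup> s \<in> F"
      using prime_filter_imp_total[OF F] c by blast
    moreover from this have "t \<rightharpoonup> s \<in> F'"
      using collapses_imp col s t by blast
    ultimately show ?thesis
      using le[OF F _ t(2) s(2)] le[OF F' _ t(3) s(3)] t(1) a b c by (auto simp: meet_comm[of L a])
  qed
qed

lemma determined_join:
  assumes a: "determined T a" "a \<in> carrier L" and b: "determined T b" "b \<in> carrier L"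
    and T: "T \<subseteq> carrier L"
  shows "determined T (a \<squnion> b)"
  unfolding determined_def
proof (intro allI impI)
  fix F F'
  assume F: "prime_filter F" and F': "prime_filter F'" and col: "collapses T F F'"
  obtain s t where s: "s \<in> T" "filter_equiv F a s" "filter_equiv F' a s"
    and t: "t \<in> T" "filter_equiv F b t" "filter_equiv F' b t"
    using a b F F' col unfolding determined_def by meson
  have c: "s \<in> carrier L" "t \<in> carrier L"
    using s t T by auto
  have le: "filter_equiv P (x \<squnion> y) v"
    if "prime_filter P" "u \<rightharpoonup> v \<in> P" "filter_equiv P x u" "filter_equiv P y v"
      "x \<in> carrier L" "y \<in> carrier L" "u \<in> carrier L" "v \<in> carrier L" for P x y u v
    using filter_equiv_join[OF that(1), of x y] filter_equiv_trans[OF that(1), of "x \<squnion> y" y v]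
      filter_equiv_imp_mem_iff[OF that(1,3,4)] that by simp
  show "\<exists>t\<in>T. filter_equiv F (a \<squnion> b) t \<and> filter_equiv F' (a \<squnion> b) t"
  proof (cases "s \<rightharpoonup> t \<in> F")
    case True
    then have "s \<rightharpoonup> t \<in> F'"
      using collapses_imp col s t by blast
    then show ?thesis
      using le[OF F True s(2) t(2)] le[OF F' _ s(3) t(3)] t(1) a b c by blast
  next
    case False
    then have "t \<rightharpoonup> s \<in> F"
      using prime_filter_imp_total[OF F] c by blast
    moreover from this have "t \<rightharpoonup> s \<in> F'"
      using collapses_imp col s t by blast
    ultimately show ?thesis
      using le[OF F _ t(2) s(2)] le[OF F' _ t(3) s(3)] s(1) a b c by (auto simp: join_comm[of L a])
  qed
qed

text \<open>If \<open>s\<close> is below \<open>t\<close> under \<open>F\<close>, then also under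
  \<open>F'\<close>, and \<open>\<top>\<close> represents the implication for both. Otherwise
  \<open>t\<close> does: should \<open>s\<close> fall below \<open>t\<close> under
  \<open>F'\<close>, the collapse must have merged \<open>t\<close> with the top, so
  \<open>t\<close> still represents the value.\<close>

lemma determined_imp:
  assumes a: "determined T a" "a \<in> carrier L" and b: "determined T b" "b \<in> carrier L"
    and T: "T \<subseteq> carrier L" "\<top> \<in> T"
  shows "determined T (a \<rightharpoonup> b)"
  unfolding determined_def
proof (intro allI impI)
  fix F F'
  assume F: "prime_filter F" and F': "prime_filter F'" and col: "collapses T F F'"
  obtain s t where s: "s \<in> T" "filter_equiv F a s" "filter_equiv F' a s"
    and t: "t \<in> T" "filter_equiv F b t" "filter_equiv F' b t"
    using a b F F' col unfolding determined_def by meson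
  have c: "s \<in> carrier L" "t \<in> carrier L"
    using s t T by auto
  have iff: "a \<rightharpoonup> b \<in> F \<longleftrightarrow> s \<rightharpoonup> t \<in> F" "a \<rightharpoonup> b \<in> F' \<longleftrightarrow> s \<rightharpoonup> t \<in> F'"
    using filter_equiv_imp_mem_iff F F' s t a b c by blast+
  have neg: "filter_equiv P (a \<rightharpoonup> b) t"
    if "prime_filter P" "a \<rightharpoonup> b \<notin> P" "filter_equiv P b t" for P
    using filter_equiv_imp[OF that(1,2)] filter_equiv_trans[OF that(1) _ that(3)] a b c by simp
  show "\<exists>t\<in>T. filter_equiv F (a \<rightharpoonup> b) t \<and> filter_equiv F' (a \<rightharpoonup> b) t"
  proof (cases "s \<rightharpoonup> t \<in> F")
    case True
    then have "s \<rightharpoonup> t \<in> F'"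
      using collapses_imp col s t by blast
    then show ?thesis
      using True iff filter_equiv_mem F F' prime_filter_top T(2) by blast
  next
    case False
    have "filter_equiv F' (a \<rightharpoonup> b) t"
    proof (cases "s \<rightharpoonup> t \<in> F'")
      case True
      then have "t \<in> F'"
        using collapses_imp_neg[OF col] False s t by blast
      then show ?thesis
        using True iff filter_equiv_mem F' by blast
    next
      case False
      then show ?thesis
        using neg F' iff t by blast
    qed
    then show ?thesis
      using neg[OF F _ t(2)] False iff t(1) by blast
  qed
qed

text \<open>For the representative \<open>t\<close>, membership in \<open>F\<close> amounts to the
  inequality \<open>\<top> \<rightharpoonup> t \<in> F\<close> between members of \<open>T\<close>,
  and a collapse preserves it.\<close>

lemma determined_mem_collapse:
  assumes a: "determined T a" "a \<in> carrier L" and T: "T \<subseteq> carrier L" "\<top> \<in> T"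
    and F: "prime_filter F" and F': "prime_filter F'" and col: "collapses T F F'" and mem: "a \<in> F"
  shows "a \<in> F'"
proof -
  obtain t where t: "t \<in> T" "filter_equiv F a t" "filter_equiv F' a t"
    using a F F' col unfolding determined_def by meson
  have c: "t \<in> carrier L"
    using t T by auto
  have "t \<in> F"
    using filter_equiv_mem_iff[OF F t(2) a(2) c] mem by blast
  then have "\<top> \<rightharpoonup> t \<in> F'"
    using collapses_imp[OF col T(2) t(1)] prime_filter_imp_right[OF F] by simp
  then have "t \<in> F'"
    using prime_filter_mp F' prime_filter_top c by blast
  then show ?thesis
    using filter_equiv_mem_iff[OF F' t(3) a(2) c] by blast
qed

text \<open>\<open>J R\<close> is a finite meet in the manner of a Jankov formula, with conjunct
  \<open>x \<rightharpoonup> y\<close> or \<open>(x \<rightharpoonup> y) \<rightharpoonup> y\<close>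
  for each pair from \<open>T\<close>. It is indexed by relations rather than filters because only
  finitely many relations live on \<open>T\<close>.\<close>

lemma collapse_formula_exists:
  assumes T: "finite T" "T \<subseteq> carrier L"
  obtains J :: "('a \<times> 'a) set \<Rightarrow> 'a"
  where "\<And>R. J R \<in> carrier L"
    and "\<And>R F. prime_filter F \<Longrightarrow> J R \<in> F \<longleftrightarrow>
      (\<forall>x\<in>T. \<forall>y\<in>T. if (x, y) \<in> R then x \<rightharpoonup> y \<in> F else x \<rightharpoonup> y \<in> F \<longrightarrow> y \<in> F)"
proof -
  have "\<exists>j. j \<in> carrier L \<and> (\<forall>F. prime_filter F \<longrightarrow> (j \<in> F \<longleftrightarrow>
      (\<forall>x\<in>T. \<forall>y\<in>T. if (x, y) \<in> R then x \<rightharpoonup> y \<in> F else x \<rightharpoonup> y \<in> F \<longrightarrow> y \<in> F)))" for R :: "('a \<times> 'a) set"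
  proof -
    let ?f = "\<lambda>(x, y). if (x, y) \<in> R then x \<rightharpoonup> y else (x \<rightharpoonup> y) \<rightharpoonup> y"
    have "finite (?f ` (T \<times> T))" "?f ` (T \<times> T) \<subseteq> carrier L"
      using T by (auto intro!: imp_closed)
    then obtain j where j: "j \<in> carrier L" "\<And>F. lattice_filter F \<Longrightarrow> j \<in> F \<longleftrightarrow> ?f ` (T \<times> T) \<subseteq> F"
      using filter_of_finite_set by meson
    have "j \<in> F \<longleftrightarrow>
        (\<forall>x\<in>T. \<forall>y\<in>T. if (x, y) \<in> R then x \<rightharpoonup> y \<in> F else x \<rightharpoonup> y \<in> F \<longrightarrow> y \<in> F)"
      if F: "prime_filter F" for F
    proof -
      have "j \<in> F \<longleftrightarrow> (\<forall>x\<in>T. \<forall>y\<in>T. ?f (x, y) \<in> F)"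
        using j(2)[of F] F by (auto simp: prime_filter_def)
      also have "\<dots> \<longleftrightarrow>
          (\<forall>x\<in>T. \<forall>y\<in>T. if (x, y) \<in> R then x \<rightharpoonup> y \<in> F else x \<rightharpoonup> y \<in> F \<longrightarrow> y \<in> F)"
      proof (intro ball_cong HOL.refl)
        fix x y
        assume "x \<in> T" "y \<in> T"
        then show "?f (x, y) \<in> F \<longleftrightarrow>
            (if (x, y) \<in> R then x \<rightharpoonup> y \<in> F else x \<rightharpoonup> y \<in> F \<longrightarrow> y \<in> F)"
          using T(2) imp_imp_mem_iff[OF F, of x y] by auto
      qed
      finally show ?thesis .
    qed
    then show ?thesis
      using j(1) by blast
  qed
  then have "\<forall>R. \<exists>j. j \<in> carrier L \<and> (\<forall>F. prime_filter F \<longrightarrow> (j \<in> F \<longleftrightarrow>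
      (\<forall>x\<in>T. \<forall>y\<in>T. if (x, y) \<in> R then x \<rightharpoonup> y \<in> F else x \<rightharpoonup> y \<in> F \<longrightarrow> y \<in> F)))"
    by (rule allI)
  from choice[OF this] show thesis
    using that by blast
qed

end

section \<open>Test algebras and generation\<close>

locale bounded_chain =
  fixes L :: "'a gorder" (structure) and b t :: 'a
  assumes eq: "(.=) = (=)"
    and antisym: "\<lbrakk>x \<in> carrier L; y \<in> carrier L; x \<sqsubseteq> y; y \<sqsubseteq> x\<rbrakk> \<Longrightarrow> x = y"
    and trans: "\<lbrakk>x \<in> carrier L; y \<in> carrier L; z \<in> carrier L; x \<sqsubseteq> y; y \<sqsubseteq> z\<rbrakk> \<Longrightarrow> x \<sqsubseteq> z"
    and total: "\<lbrakk>x \<in> carrier L; y \<in> carrier L\<rbrakk> \<Longrightarrow> x \<sqsubseteq> y \<or> y \<sqsubseteq> x"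
    and bot: "b \<in> carrier L" "x \<in> carrier L \<Longrightarrow> b \<sqsubseteq> x"
    and top: "t \<in> carrier L" "x \<in> carrier L \<Longrightarrow> x \<sqsubseteq> t"
begin

lemma goedel_chain:
  shows "goedel_algebra L" "\<bottom> = b" "\<top> = t"
    and "\<And>x y. \<lbrakk>x \<in> carrier L; y \<in> carrier L\<rbrakk> \<Longrightarrow> x \<sqinter> y = (if x \<sqsubseteq> y then x else y)"
    and "\<And>x y. \<lbrakk>x \<in> carrier L; y \<in> carrier L\<rbrakk> \<Longrightarrow> x \<squnion> y = (if x \<sqsubseteq> y then y else x)"
    and "\<And>x y. \<lbrakk>x \<in> carrier L; y \<in> carrier L\<rbrakk> \<Longrightarrow> heyting_imp L x y = (if x \<sqsubseteq> y then t else y)"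
proof -
  have refl: "x \<sqsubseteq> x" if "x \<in> carrier L" for x
    using total that by blast
  have m: "z \<sqsubseteq> (if x \<sqsubseteq> y then x else y) \<longleftrightarrow> z \<sqsubseteq> x \<and> z \<sqsubseteq> y"
    if "x \<in> carrier L" "y \<in> carrier L" "z \<in> carrier L" for x y z
    using total[of x y] trans[of z x y] trans[of z y x] that by auto
  have j: "(if x \<sqsubseteq> y then y else x) \<sqsubseteq> z \<longleftrightarrow> x \<sqsubseteq> z \<and> y \<sqsubseteq> z"
    if "x \<in> carrier L" "y \<in> carrier L" "z \<in> carrier L" for x y z
    using total[of x y] trans[of x y z] trans[of y x z] that by auto
  have i: "z \<sqsubseteq> (if x \<sqsubseteq> y then t else y) \<longleftrightarrow> (if x \<sqsubseteq> z then x else z) \<sqsubseteq> y"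
    if "x \<in> carrier L" "y \<in> carrier L" "z \<in> carrier L" for x y z
    using total[of x z] trans[of z x y] trans[of x z y] top that by auto
  have p: "(if (if x \<sqsubseteq> y then t else y) \<sqsubseteq> (if y \<sqsubseteq> x then t else x)
      then (if y \<sqsubseteq> x then t else x) else (if x \<sqsubseteq> y then t else y)) = t"
    if "x \<in> carrier L" "y \<in> carrier L" for x y
    using total[of x y] antisym[of x t] antisym[of y t] top that by auto
  interpret ops: goedel_operations L b t "\<lambda>x y. if x \<sqsubseteq> y then x else y"
    "\<lambda>x y. if x \<sqsubseteq> y then y else x" "\<lambda>x y. if x \<sqsubseteq> y then t else y"
    by unfold_locales (fact eq refl antisym trans bot top m j i p | simp add: top)+
  show "goedel_algebra L" "\<bottom> = b" "\<top> = t"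
    "\<And>x y. \<lbrakk>x \<in> carrier L; y \<in> carrier L\<rbrakk> \<Longrightarrow> x \<sqinter> y = (if x \<sqsubseteq> y then x else y)"
    "\<And>x y. \<lbrakk>x \<in> carrier L; y \<in> carrier L\<rbrakk> \<Longrightarrow> x \<squnion> y = (if x \<sqsubseteq> y then y else x)"
    "\<And>x y. \<lbrakk>x \<in> carrier L; y \<in> carrier L\<rbrakk> \<Longrightarrow> heyting_imp L x y = (if x \<sqsubseteq> y then t else y)"
    by (fact ops.goedel)+
qed

end

context goedel_algebra
begin

text \<open>The tag \<^const>\<open>Inl\<close> moves a subalgebra into the type of the test algebras.\<close>

definition tagged :: "'a set \<Rightarrow> ('a + nat) gorder"
  where "tagged A = \<lparr>carrier = Inl ` A, eq = (=), le = (\<lambda>u v. projl u \<sqsubseteq> projl v)\<rparr>"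

lemma carrier_tagged: "carrier (tagged A) = Inl ` A"
  by (simp add: tagged_def)

lemma tagged_subalgebra:
  assumes sub: "A \<subseteq> carrier L" and bt: "\<bottom> \<in> A" "\<top> \<in> A"
    and cl: "\<forall>x\<in>A. \<forall>y\<in>A. x \<sqinter> y \<in> A \<and> x \<squnion> y \<in> A \<and> x \<rightharpoonup> y \<in> A"
  shows "goedel_algebra (tagged A)"
    and "\<bottom>\<^bsub>tagged A\<^esub> = Inl \<bottom>" and "\<top>\<^bsub>tagged A\<^esub> = Inl \<top>"
    and "\<And>x y. \<lbrakk>x \<in> A; y \<in> A\<rbrakk> \<Longrightarrow> Inl x \<sqinter>\<^bsub>tagged A\<^esub> Inl y = Inl (x \<sqinter> y)"
    and "\<And>x y. \<lbrakk>x \<in> A; y \<in> A\<rbrakk> \<Longrightarrow> Inl x \<squnion>\<^bsub>tagged A\<^esub> Inl y = Inl (x \<squnion> y)"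
    and "\<And>x y. \<lbrakk>x \<in> A; y \<in> A\<rbrakk> \<Longrightarrow> heyting_imp (tagged A) (Inl x) (Inl y) = Inl (x \<rightharpoonup> y)"
proof -
  have mem: "x \<in> carrier L" if "x \<in> A" for x
    using sub that by blast
  interpret A: goedel_operations "tagged A" "Inl \<bottom>" "Inl \<top>" "\<lambda>u v. Inl (projl u \<sqinter> projl v)"
    "\<lambda>u v. Inl (projl u \<squnion> projl v)" "\<lambda>u v. Inl (projl u \<rightharpoonup> projl v)"
    by unfold_locales
      (force simp: tagged_def mem bt cl le_meet_iff join_le_iff le_imp_iff prelinear
        intro: le_trans le_antisym)+
  show "goedel_algebra (tagged A)" "\<bottom>\<^bsub>tagged A\<^esub> = Inl \<bottom>" "\<top>\<^bsub>tagged A\<^esub> = Inl \<top>"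
    by (fact A.goedel)+
  show "\<And>x y. \<lbrakk>x \<in> A; y \<in> A\<rbrakk> \<Longrightarrow> Inl x \<sqinter>\<^bsub>tagged A\<^esub> Inl y = Inl (x \<sqinter> y)"
    "\<And>x y. \<lbrakk>x \<in> A; y \<in> A\<rbrakk> \<Longrightarrow> Inl x \<squnion>\<^bsub>tagged A\<^esub> Inl y = Inl (x \<squnion> y)"
    "\<And>x y. \<lbrakk>x \<in> A; y \<in> A\<rbrakk> \<Longrightarrow> heyting_imp (tagged A) (Inl x) (Inl y) = Inl (x \<rightharpoonup> y)"
    using A.goedel(4-6) by (simp_all add: carrier_tagged)
qed

text \<open>Induction over the generators. The elements satisfying \<open>P\<close> form a
  subalgebra \<open>A\<close>; freeness gives a homomorphism into \<open>A\<close> fixing the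
  generators. Followed by the inclusion it is the identity, by uniqueness, so \<open>A\<close> is
  everything.\<close>

lemma free_generated:
  assumes free: "free_goedel_algebra TYPE('a + nat) L S q"
    and a: "a \<in> carrier L"
    and gen: "\<And>s. s \<in> S \<Longrightarrow> P (q s)" and bt: "P \<bottom>" "P \<top>"
    and meet: "\<And>x y. \<lbrakk>x \<in> carrier L; y \<in> carrier L; P x; P y\<rbrakk> \<Longrightarrow> P (x \<sqinter> y)"
    and join: "\<And>x y. \<lbrakk>x \<in> carrier L; y \<in> carrier L; P x; P y\<rbrakk> \<Longrightarrow> P (x \<squnion> y)"
    and imp: "\<And>x y. \<lbrakk>x \<in> carrier L; y \<in> carrier L; P x; P y\<rbrakk> \<Longrightarrow> P (x \<rightharpoonup> y)"
  shows "P a"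
proof -
  define A where "A = {x \<in> carrier L. P x}"
  have sub: "A \<subseteq> carrier L"
    by (auto simp: A_def)
  have memA: "\<bottom> \<in> A" "\<top> \<in> A"
    "\<forall>x\<in>A. \<forall>y\<in>A. x \<sqinter> y \<in> A \<and> x \<squnion> y \<in> A \<and> x \<rightharpoonup> y \<in> A"
    using bt meet join imp by (auto simp: A_def)
  note tA = tagged_subalgebra[OF sub memA]
  have memL: "\<forall>x\<in>carrier L. \<forall>y\<in>carrier L.
      x \<sqinter> y \<in> carrier L \<and> x \<squnion> y \<in> carrier L \<and> x \<rightharpoonup> y \<in> carrier L"
    by simp
  note tL = tagged_subalgebra[OF order_refl bottom_closed top_closed memL]
  have q: "q \<in> S \<rightarrow> carrier L"
    and univ: "\<And>H f. \<lbrakk>goedel_algebra H; f \<in> S \<rightarrow> carrier H\<rbrakk> \<Longrightarrow>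
      \<exists>!g. g \<in> extensional (carrier L) \<and> heyting_hom L (H :: ('a + nat) gorder) g \<and> (\<forall>s\<in>S. g (q s) = f s)"
    using free by (simp_all add: free_goedel_algebra_def)
  have "(\<lambda>s. Inl (q s)) \<in> S \<rightarrow> carrier (tagged A)"
    using q gen by (auto simp: carrier_tagged A_def)
  then obtain g where g: "g \<in> extensional (carrier L)" "heyting_hom L (tagged A) g"
    "\<forall>s\<in>S. g (q s) = Inl (q s)"
    using univ[OF tA(1)] by blast
  have gA: "g x \<in> Inl ` A" if "x \<in> carrier L" for x
    using g(2) that by (auto simp: heyting_hom_def carrier_tagged)
  \<comment> \<open>Composition with the inclusion leaves \<open>g\<close> unchanged as a function,
    because on \<open>A\<close> the operations of both tagged structures agree.\<close>
  have "heyting_hom L (tagged (carrier L)) g"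
    unfolding heyting_hom_def
  proof (intro conjI ballI)
    show "g \<in> carrier L \<rightarrow> carrier (tagged (carrier L))"
      using gA sub by (fastforce simp: carrier_tagged)
    show "g \<bottom> = \<bottom>\<^bsub>tagged (carrier L)\<^esub>" "g \<top> = \<top>\<^bsub>tagged (carrier L)\<^esub>"
      using g(2) tA(2,3) tL(2,3) by (simp_all add: heyting_hom_def)
    fix x y
    assume xy: "x \<in> carrier L" "y \<in> carrier L"
    obtain u v where uv: "u \<in> A" "g x = Inl u" "v \<in> A" "g y = Inl v"
      using gA xy by blast
    have c: "u \<in> carrier L" "v \<in> carrier L"
      using uv sub by auto
    show "g (x \<sqinter> y) = g x \<sqinter>\<^bsub>tagged (carrier L)\<^esub> g y"
      "g (x \<squnion> y) = g x \<squnion>\<^bsub>tagged (carrier L)\<^esub> g y"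
      "g (x \<rightharpoonup> y) = heyting_imp (tagged (carrier L)) (g x) (g y)"
      using g(2) xy tA(4-6)[OF uv(1,3)] tL(4-6)[OF c] by (simp_all add: heyting_hom_def uv)
  qed
  \<comment> \<open>The competitor is the tagged identity, restricted because uniqueness is asserted
    among extensional maps only.\<close>
  moreover have "heyting_hom L (tagged (carrier L)) (restrict Inl (carrier L))"
    using tL(2-) by (auto simp: heyting_hom_def carrier_tagged)
  moreover have "(\<lambda>s. Inl (q s)) \<in> S \<rightarrow> carrier (tagged (carrier L))"
    using q by (auto simp: carrier_tagged)
  moreover have "\<forall>s\<in>S. restrict Inl (carrier L) (q s) = Inl (q s)"
    using q by auto
  ultimately have "g = restrict Inl (carrier L)"
    using univ[OF tL(1)] g(1,3) restrict_extensional by blast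
  then have "Inl a \<in> (Inl :: 'a \<Rightarrow> 'a + nat) ` A"
    using gA[OF a] a by simp
  then show ?thesis
    by (auto simp: A_def)
qed

end

section \<open>Prolonging the chain of a prime filter\<close>

context goedel_algebra
begin

text \<open>The chain of the classes modulo \<open>F\<close> whose top class \<open>F\<close> is replaced by a copy of the natural
  numbers in descending order. It projects onto the chain of all classes modulo \<open>F\<close>;
  \<open>projects_to F u a\<close> says that \<open>u\<close> lies above the class of \<open>a\<close>.\<close>

definition class_rep :: "'a set \<Rightarrow> 'a \<Rightarrow> 'a"
  where "class_rep F x = (SOME y. y \<in> carrier L \<and> filter_equiv F x y)"

definition prolonged_le :: "'a set \<Rightarrow> 'a + nat \<Rightarrow> 'a + nat \<Rightarrow> bool"
  where "prolonged_le F u v \<longleftrightarrow> (case u of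
      Inl r \<Rightarrow> (case v of Inl r' \<Rightarrow> r \<rightharpoonup> r' \<in> F | Inr n \<Rightarrow> True)
    | Inr m \<Rightarrow> (case v of Inl r' \<Rightarrow> False | Inr n \<Rightarrow> n \<le> m))"

definition prolonged_chain :: "'a set \<Rightarrow> ('a + nat) gorder"
  where "prolonged_chain F = \<lparr>carrier = Inl ` class_rep F ` (carrier L - F) \<union> range Inr,
    eq = (=), le = prolonged_le F\<rparr>"

definition projects_to :: "'a set \<Rightarrow> 'a + nat \<Rightarrow> 'a \<Rightarrow> bool"
  where "projects_to F u a \<longleftrightarrow> (case u of
      Inl r \<Rightarrow> a \<notin> F \<and> r \<in> carrier L \<and> filter_equiv F a r
    | Inr n \<Rightarrow> a \<in> F)"

context
  fixes F
  assumes F: "prime_filter F"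
begin

lemma class_rep:
  assumes "x \<in> carrier L"
  shows "class_rep F x \<in> carrier L" "filter_equiv F x (class_rep F x)"
proof -
  have "\<exists>y. y \<in> carrier L \<and> filter_equiv F x y"
    using assms filter_equiv_refl[OF F] by blast
  from someI_ex[OF this] show "class_rep F x \<in> carrier L" "filter_equiv F x (class_rep F x)"
    by (auto simp: class_rep_def)
qed

text \<open>Equivalent elements give \<open>SOME\<close> the same predicate, hence the same choice.
  Canonical representatives make the chain antisymmetric with respect to equality, while keeping it
  inside the type \<open>'a + nat\<close> of the test algebras, where sets of elements would not
  fit.\<close>

lemma class_rep_eq:
  assumes "filter_equiv F x y" "x \<in> carrier L" "y \<in> carrier L"
  shows "class_rep F x = class_rep F y"
proof -
  have "filter_equiv F x z \<longleftrightarrow> filter_equiv F y z" if "z \<in> carrier L" for z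
    using filter_equiv_trans[OF F] filter_equiv_sym assms that by blast
  then have "(\<lambda>z. z \<in> carrier L \<and> filter_equiv F x z) = (\<lambda>z. z \<in> carrier L \<and> filter_equiv F y z)"
    by blast
  then show ?thesis
    by (simp add: class_rep_def)
qed

lemma class_rep_le_iff:
  "\<lbrakk>x \<in> carrier L; y \<in> carrier L\<rbrakk> \<Longrightarrow> class_rep F x \<rightharpoonup> class_rep F y \<in> F \<longleftrightarrow> x \<rightharpoonup> y \<in> F"
  using filter_equiv_imp_mem_iff[OF F class_rep(2) class_rep(2), of x y] class_rep(1) by simp

lemma prolonged_chain_cases:
  assumes "u \<in> carrier (prolonged_chain F)"
  obtains x where "u = Inl (class_rep F x)" "x \<in> carrier L" "x \<notin> F" | n where "u = Inr n"
  using assms by (auto simp: prolonged_chain_def)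

lemma prolonged_chain:
  shows "goedel_algebra (prolonged_chain F)"
    and "\<bottom>\<^bsub>prolonged_chain F\<^esub> = Inl (class_rep F \<bottom>)" and "\<top>\<^bsub>prolonged_chain F\<^esub> = Inr 0"
    and "\<And>u v. \<lbrakk>u \<in> carrier (prolonged_chain F); v \<in> carrier (prolonged_chain F)\<rbrakk> \<Longrightarrow>
      u \<sqinter>\<^bsub>prolonged_chain F\<^esub> v = (if prolonged_le F u v then u else v)"
    and "\<And>u v. \<lbrakk>u \<in> carrier (prolonged_chain F); v \<in> carrier (prolonged_chain F)\<rbrakk> \<Longrightarrow>
      u \<squnion>\<^bsub>prolonged_chain F\<^esub> v = (if prolonged_le F u v then v else u)"
    and "\<And>u v. \<lbrakk>u \<in> carrier (prolonged_chain F); v \<in> carrier (prolonged_chain F)\<rbrakk> \<Longrightarrow>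
      heyting_imp (prolonged_chain F) u v = (if prolonged_le F u v then Inr 0 else v)"
proof -
  let ?H = "prolonged_chain F"
  have eq: "eq ?H = (=)" and le: "le ?H = prolonged_le F"
    by (simp_all add: prolonged_chain_def)
  have antisym: "u = v"
    if "u \<in> carrier ?H" "v \<in> carrier ?H" "u \<sqsubseteq>\<^bsub>?H\<^esub> v" "v \<sqsubseteq>\<^bsub>?H\<^esub> u" for u v
    by (rule prolonged_chain_cases[OF that(1)]; rule prolonged_chain_cases[OF that(2)])
      (use that(3,4) in \<open>auto simp: le prolonged_le_def class_rep_le_iff filter_equiv_def
        intro: class_rep_eq\<close>)
  have trans: "u \<sqsubseteq>\<^bsub>?H\<^esub> w"
    if "u \<in> carrier ?H" "v \<in> carrier ?H" "w \<in> carrier ?H" "u \<sqsubseteq>\<^bsub>?H\<^esub> v" "v \<sqsubseteq>\<^bsub>?H\<^esub> w" for u v w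
    by (rule prolonged_chain_cases[OF that(1)]; rule prolonged_chain_cases[OF that(2)];
        rule prolonged_chain_cases[OF that(3)])
      (use that(4,5) in \<open>auto simp: le prolonged_le_def class_rep_le_iff
        intro: prime_filter_imp_trans[OF F]\<close>)
  have total: "u \<sqsubseteq>\<^bsub>?H\<^esub> v \<or> v \<sqsubseteq>\<^bsub>?H\<^esub> u" if "u \<in> carrier ?H" "v \<in> carrier ?H" for u v
    by (rule prolonged_chain_cases[OF that(1)]; rule prolonged_chain_cases[OF that(2)])
      (use prime_filter_imp_total[OF F] in \<open>auto simp: le prolonged_le_def class_rep_le_iff\<close>)
  have bot: "Inl (class_rep F \<bottom>) \<in> carrier ?H"
    using prime_filter_bottom[OF F] by (auto simp: prolonged_chain_def)
  have least: "Inl (class_rep F \<bottom>) \<sqsubseteq>\<^bsub>?H\<^esub> u" if "u \<in> carrier ?H" for u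
    by (rule prolonged_chain_cases[OF that])
      (auto simp: le prolonged_le_def class_rep_le_iff prime_filter_imp_le[OF F])
  have top: "Inr 0 \<in> carrier ?H" and greatest: "\<And>u. u \<in> carrier ?H \<Longrightarrow> u \<sqsubseteq>\<^bsub>?H\<^esub> Inr 0"
    by (auto simp: prolonged_chain_def prolonged_le_def split: sum.split)
  interpret H: bounded_chain ?H "Inl (class_rep F \<bottom>)" "Inr 0"
    by unfold_locales (fact eq antisym trans total bot least top greatest)+
  show "goedel_algebra ?H" "\<bottom>\<^bsub>?H\<^esub> = Inl (class_rep F \<bottom>)" "\<top>\<^bsub>?H\<^esub> = Inr 0"
    "\<And>u v. \<lbrakk>u \<in> carrier ?H; v \<in> carrier ?H\<rbrakk> \<Longrightarrow> u \<sqinter>\<^bsub>?H\<^esub> v = (if prolonged_le F u v then u else v)"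
    "\<And>u v. \<lbrakk>u \<in> carrier ?H; v \<in> carrier ?H\<rbrakk> \<Longrightarrow> u \<squnion>\<^bsub>?H\<^esub> v = (if prolonged_le F u v then v else u)"
    "\<And>u v. \<lbrakk>u \<in> carrier ?H; v \<in> carrier ?H\<rbrakk> \<Longrightarrow>
      heyting_imp ?H u v = (if prolonged_le F u v then Inr 0 else v)"
    using H.goedel_chain unfolding le by blast+
qed

lemma projects_to_cong:
  assumes "projects_to F u a" "filter_equiv F a b" "a \<in> carrier L" "b \<in> carrier L"
  shows "projects_to F u b"
proof -
  have "a \<in> F \<longleftrightarrow> b \<in> F"
    using filter_equiv_mem_iff[OF F assms(2-4)] .
  moreover have "filter_equiv F b r" if "filter_equiv F a r" "r \<in> carrier L" for r
    using filter_equiv_trans[OF F filter_equiv_sym[OF assms(2)]] that assms by blast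
  ultimately show ?thesis
    using assms(1) by (cases u) (simp_all add: projects_to_def)
qed

text \<open>The projection is monotone but not injective on the copy of the naturals. The third
  claim concerns two points of that copy: their implication in the prolonged chain is
  \<open>v\<close>, while \<open>a \<rightharpoonup> b\<close> lies in the top class
  \<open>F\<close>, over which \<open>v\<close> sits.\<close>

lemma projects_to_le:
  assumes "projects_to F u a" "projects_to F v b" "a \<in> carrier L" "b \<in> carrier L"
  shows "prolonged_le F u v \<Longrightarrow> a \<rightharpoonup> b \<in> F" and "\<not> prolonged_le F u v \<Longrightarrow> b \<rightharpoonup> a \<in> F"
    and "\<lbrakk>\<not> prolonged_le F u v; a \<rightharpoonup> b \<in> F\<rbrakk> \<Longrightarrow> projects_to F v (a \<rightharpoonup> b)"
proof -
  have iff: "a \<rightharpoonup> b \<in> F \<longleftrightarrow> r \<rightharpoonup> r' \<in> F" if "u = Inl r" "v = Inl r'" for r r'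
    using filter_equiv_imp_mem_iff[OF F, of a r b r'] assms that by (simp add: projects_to_def)
  show le: "a \<rightharpoonup> b \<in> F" if "prolonged_le F u v"
    using that assms iff prime_filter_imp_right[OF F, of a b]
    by (cases u; cases v) (simp_all add: projects_to_def prolonged_le_def)
  show "b \<rightharpoonup> a \<in> F" if "\<not> prolonged_le F u v"
    using that assms iff prime_filter_imp_right[OF F, of b a] prime_filter_imp_total[OF F, of a b]
    by (cases u; cases v) (simp_all add: projects_to_def prolonged_le_def)
  show "projects_to F v (a \<rightharpoonup> b)" if "\<not> prolonged_le F u v" "a \<rightharpoonup> b \<in> F"
    using that assms iff prime_filter_mp[OF F, of a b]
    by (cases u; cases v) (simp_all add: projects_to_def prolonged_le_def)
qed

end
end

section \<open>Differences in a free Goedel algebra\<close>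

context goedel_algebra
begin

text \<open>\<open>z \<rightharpoonup> x \<notin> F\<close> says that \<open>z\<close> is strictly
  above \<open>x\<close> in the chain of \<open>F\<close>. Counting such \<open>z\<close> in
  \<open>T\<close> measures the depth of \<open>x\<close> and reverses the order, which is why the
  naturals are ordered descendingly in the prolonged chain.\<close>

lemma card_upset_le_iff:
  assumes F: "prime_filter F" and T: "finite T" "T \<subseteq> carrier L" and xy: "x \<in> T" "y \<in> T"
  shows "card {z \<in> T. z \<rightharpoonup> y \<notin> F} \<le> card {z \<in> T. z \<rightharpoonup> x \<notin> F} \<longleftrightarrow> x \<rightharpoonup> y \<in> F"
proof
  assume "x \<rightharpoonup> y \<in> F"
  then have "{z \<in> T. z \<rightharpoonup> y \<notin> F} \<subseteq> {z \<in> T. z \<rightharpoonup> x \<notin> F}"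
    using prime_filter_imp_trans[OF F, of _ x y] T xy by blast
  then show "card {z \<in> T. z \<rightharpoonup> y \<notin> F} \<le> card {z \<in> T. z \<rightharpoonup> x \<notin> F}"
    using T by (simp add: card_mono)
next
  assume le: "card {z \<in> T. z \<rightharpoonup> y \<notin> F} \<le> card {z \<in> T. z \<rightharpoonup> x \<notin> F}"
  show "x \<rightharpoonup> y \<in> F"
  proof (rule ccontr)
    assume nle: "x \<rightharpoonup> y \<notin> F"
    then have "y \<rightharpoonup> x \<in> F"
      using prime_filter_imp_total[OF F, of x y] T xy by blast
    then have "{z \<in> T. z \<rightharpoonup> x \<notin> F} \<subseteq> {z \<in> T. z \<rightharpoonup> y \<notin> F}"
      using prime_filter_imp_trans[OF F, of _ y x] T xy by blast
    moreover have "x \<in> {z \<in> T. z \<rightharpoonup> y \<notin> F}" "x \<notin> {z \<in> T. z \<rightharpoonup> x \<notin> F}"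
      using nle xy prime_filter_imp_refl[OF F, of x] T by auto
    ultimately have "{z \<in> T. z \<rightharpoonup> x \<notin> F} \<subset> {z \<in> T. z \<rightharpoonup> y \<notin> F}"
      by blast
    then have "card {z \<in> T. z \<rightharpoonup> x \<notin> F} < card {z \<in> T. z \<rightharpoonup> y \<notin> F}"
      using T by (simp add: psubset_card_mono)
    then show False
      using le by simp
  qed
qed

text \<open>This is openness on spectra of the inclusion of the subalgebra generated by \<open>T\<close>: it makes
  differences computed in that finite subalgebra persist in the free algebra. Generators of \<open>T\<close> that
  lie in \<open>F'\<close> are sent to the upper part of the prolonged chain according to their \<open>F\<close>-order.\<close>

lemma free_lift_collapse:
  assumes free: "free_goedel_algebra TYPE('a + nat) L S q"
    and T: "finite T" "T \<subseteq> insert \<bottom> (insert \<top> (q ` S))"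
    and F: "prime_filter F" and F': "prime_filter F'" and col: "collapses T F F'"
  obtains F'' where "prime_filter F''" "F'' \<subseteq> F'"
    and "\<And>x y. \<lbrakk>x \<in> T; y \<in> T\<rbrakk> \<Longrightarrow> x \<rightharpoonup> y \<in> F'' \<longleftrightarrow> x \<rightharpoonup> y \<in> F"
proof -
  let ?H = "prolonged_chain F'"
  note H = prolonged_chain[OF F']
  have q: "q \<in> S \<rightarrow> carrier L"
    and univ: "\<And>H f. \<lbrakk>goedel_algebra H; f \<in> S \<rightarrow> carrier H\<rbrakk> \<Longrightarrow>
      \<exists>!g. g \<in> extensional (carrier L) \<and> heyting_hom L (H :: ('a + nat) gorder) g \<and> (\<forall>s\<in>S. g (q s) = f s)"
    using free by (simp_all add: free_goedel_algebra_def)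
  have qS: "q s \<in> carrier L" if "s \<in> S" for s
    using q that by auto
  have TL: "T \<subseteq> carrier L"
    using T(2) qS by auto
  define \<phi> :: "'a \<Rightarrow> 'a + nat" where
    "\<phi> x = (if x \<in> F' then Inr (card {z \<in> T. z \<rightharpoonup> x \<notin> F}) else Inl (class_rep F' x))" for x
  have "(\<lambda>s. \<phi> (q s)) \<in> S \<rightarrow> carrier ?H"
    by (auto simp: \<phi>_def prolonged_chain_def qS)
  then obtain w where w: "heyting_hom L ?H w" and wq: "\<And>s. s \<in> S \<Longrightarrow> w (q s) = \<phi> (q s)"
    using univ[OF H(1)] by blast
  have wH: "w x \<in> carrier ?H" if "x \<in> carrier L" for x
    using w that by (auto simp: heyting_hom_def)
  have wbot: "w \<bottom> = Inl (class_rep F' \<bottom>)" and wtop: "w \<top> = Inr 0"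
    using w H(2,3) by (simp_all add: heyting_hom_def)
  have wmeet: "w (x \<sqinter> y) = (if prolonged_le F' (w x) (w y) then w x else w y)"
    and wjoin: "w (x \<squnion> y) = (if prolonged_le F' (w x) (w y) then w y else w x)"
    and wimp: "w (x \<rightharpoonup> y) = (if prolonged_le F' (w x) (w y) then Inr 0 else w y)"
    if "x \<in> carrier L" "y \<in> carrier L" for x y
    using w H(4-6)[OF wH[OF that(1)] wH[OF that(2)]] that by (simp_all add: heyting_hom_def)
  \<comment> \<open>The depth of \<open>\<top>\<close> is 0, so \<open>\<phi>\<close> sends
    \<open>\<top>\<close> to the top \<open>Inr 0\<close>. Hence \<open>w\<close> and
    \<open>\<phi>\<close> agree on all of \<open>T\<close>, on the constants as well as on the
    generators.\<close>
  have above_top: "{z \<in> T. z \<rightharpoonup> \<top> \<notin> F} = {}"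
    using prime_filter_imp_right[OF F _ prime_filter_top[OF F]] TL by blast
  have "\<phi> \<top> = Inr 0"
    unfolding \<phi>_def above_top using prime_filter_top[OF F'] by simp
  moreover have "\<phi> \<bottom> = Inl (class_rep F' \<bottom>)"
    using prime_filter_bottom[OF F'] by (simp add: \<phi>_def)
  ultimately have wT: "w x = \<phi> x" if "x \<in> T" for x
    using that T(2) wbot wtop wq by auto
  have le_top: "prolonged_le F' u (Inr 0)" for u
    by (cases u) (simp_all add: prolonged_le_def)
  have top_le: "prolonged_le F' (Inr 0) u \<longleftrightarrow> u = Inr 0" for u
    by (cases u) (simp_all add: prolonged_le_def)

  \<comment> \<open>Followed by the projection, \<open>w\<close> is the quotient map modulo
    \<open>F'\<close>. For generators, inside \<open>T\<close> or not, this is built into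
    \<open>\<phi>\<close>; it extends to all elements by induction.\<close>
  have proj: "projects_to F' (w a) a" if "a \<in> carrier L" for a
    using free that
  proof (rule free_generated)
    show "projects_to F' (w (q s)) (q s)" if "s \<in> S" for s
      using that class_rep[OF F' qS[OF that]] by (simp add: wq \<phi>_def projects_to_def)
    show "projects_to F' (w \<bottom>) \<bottom>"
      using class_rep[OF F', of \<bottom>] prime_filter_bottom[OF F'] by (simp add: wbot projects_to_def)
    show "projects_to F' (w \<top>) \<top>"
      using prime_filter_top[OF F'] by (simp add: wtop projects_to_def)
    fix x y
    assume c: "x \<in> carrier L" "y \<in> carrier L"
      and p: "projects_to F' (w x) x" "projects_to F' (w y) y"
    have mj: "projects_to F' u (a \<sqinter> b)" "projects_to F' v (a \<squnion> b)"
      if "projects_to F' u a" "projects_to F' v b" "a \<rightharpoonup> b \<in> F'" "a \<in> carrier L" "b \<in> carrier L"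
      for u v a b
      using that projects_to_cong[OF F' that(1) filter_equiv_sym[OF filter_equiv_meet[OF F' that(3)]]]
        projects_to_cong[OF F' that(2) filter_equiv_sym[OF filter_equiv_join[OF F' that(3)]]]
      by simp_all
    show "projects_to F' (w (x \<sqinter> y)) (x \<sqinter> y)"
      using mj(1)[OF p _ c] mj(1)[OF p(2,1) _ c(2,1)] projects_to_le(1,2)[OF F' p c]
      by (simp add: wmeet[OF c] meet_comm[of L y])
    show "projects_to F' (w (x \<squnion> y)) (x \<squnion> y)"
      using mj(2)[OF p _ c] mj(2)[OF p(2,1) _ c(2,1)] projects_to_le(1,2)[OF F' p c]
      by (simp add: wjoin[OF c] join_comm[of L y])
    show "projects_to F' (w (x \<rightharpoonup> y)) (x \<rightharpoonup> y)"
    proof (cases "prolonged_le F' (w x) (w y)")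
      case True
      then show ?thesis
        using projects_to_le(1)[OF F' p c] by (simp add: wimp[OF c] projects_to_def)
    next
      case False
      then show ?thesis
        using projects_to_le(3)[OF F' p c] c
          projects_to_cong[OF F' p(2) filter_equiv_sym[OF filter_equiv_imp[OF F', of x y]]]
        by (cases "x \<rightharpoonup> y \<in> F'") (simp_all add: wimp[OF c])
    qed
  qed

  \<comment> \<open>The preimage of the top. It is prime because the target is a nontrivial chain,
    and it lies in \<open>F'\<close> because \<open>Inr 0\<close> sits over the top class modulo
    \<open>F'\<close>.\<close>
  define F'' where "F'' = {a \<in> carrier L. w a = Inr 0}"
  \<comment> \<open>Under \<open>F\<close>, the members of \<open>T\<close> in \<open>F'\<close> lie
    strictly above those outside \<open>F'\<close>, and among the latter both filters induce the
    same order. Only the order inside \<open>F'\<close> is lost in the collapse, and the depths in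
    \<open>\<phi>\<close> restore it.\<close>
  have trace: "x \<in> F' \<Longrightarrow> x \<rightharpoonup> y \<in> F \<Longrightarrow> y \<in> F'" "y \<in> F' \<Longrightarrow> x \<notin> F' \<Longrightarrow> x \<rightharpoonup> y \<in> F"
    "x \<notin> F' \<Longrightarrow> y \<notin> F' \<Longrightarrow> x \<rightharpoonup> y \<in> F' \<longleftrightarrow> x \<rightharpoonup> y \<in> F"
    if "x \<in> T" "y \<in> T" for x y
  proof -
    have c: "x \<in> carrier L" "y \<in> carrier L"
      using that TL by auto
    show "y \<in> F'" if "x \<in> F'" "x \<rightharpoonup> y \<in> F"
      using collapses_imp[OF col \<open>x \<in> T\<close> \<open>y \<in> T\<close>] prime_filter_mp[OF F'] that c by blast
    show "x \<rightharpoonup> y \<in> F" if "y \<in> F'" "x \<notin> F'"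
      using collapses_imp[OF col \<open>y \<in> T\<close> \<open>x \<in> T\<close>] prime_filter_mp[OF F'] that c
        prime_filter_imp_total[OF F c] by blast
    show "x \<rightharpoonup> y \<in> F' \<longleftrightarrow> x \<rightharpoonup> y \<in> F" if "x \<notin> F'" "y \<notin> F'"
      using collapses_imp[OF col \<open>x \<in> T\<close> \<open>y \<in> T\<close>] collapses_imp_neg[OF col \<open>x \<in> T\<close> \<open>y \<in> T\<close>] that
      by blast
  qed
  have le_iff: "prolonged_le F' (w x) (w y) \<longleftrightarrow> x \<rightharpoonup> y \<in> F" if xy: "x \<in> T" "y \<in> T" for x y
  proof (cases "x \<in> F'")
    case True
    show ?thesis
    proof (cases "y \<in> F'")
      case True
      then show ?thesis
        using \<open>x \<in> F'\<close> card_upset_le_iff[OF F T(1) TL xy] by (simp add: wT xy \<phi>_def prolonged_le_def)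
    next
      case False
      then show ?thesis
        using \<open>x \<in> F'\<close> trace(1)[OF xy] by (auto simp add: wT xy \<phi>_def prolonged_le_def)
    qed
  next
    case False
    then show ?thesis
      using trace(2,3)[OF xy] class_rep_le_iff[OF F', of x y] TL xy
      by (cases "y \<in> F'") (simp_all add: wT \<phi>_def prolonged_le_def subsetD)
  qed
  show thesis
  proof (rule that)
    show "F'' \<subseteq> F'"
      using proj by (fastforce simp: F''_def projects_to_def)
    \<comment> \<open>If \<open>w x\<close> is not below \<open>w y\<close>, the implication goes to
      \<open>w y\<close>, and this is not the top since everything is below the top.\<close>
    show "x \<rightharpoonup> y \<in> F'' \<longleftrightarrow> x \<rightharpoonup> y \<in> F" if "x \<in> T" "y \<in> T" for x y
    proof -
      have "x \<in> carrier L" "y \<in> carrier L"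
        using that TL by auto
      then show ?thesis
        using le_iff[OF that] le_top by (auto simp: F''_def wimp)
    qed
    have "y \<in> F''" if "x \<in> F''" "y \<in> carrier L" "x \<sqsubseteq> y" for x y
    proof -
      have "x \<squnion> y = y"
        using that le_iff_meet by (simp add: F''_def)
      then show ?thesis
        using wjoin[of x y] that top_le[of "w y"] by (auto simp: F''_def split: if_splits)
    qed
    moreover have "x \<sqinter> y \<in> F''" if "x \<in> F''" "y \<in> F''" for x y
      using that by (simp add: F''_def wmeet)
    moreover have "x \<in> F'' \<or> y \<in> F''" if "x \<in> carrier L" "y \<in> carrier L" "x \<squnion> y \<in> F''" for x y
      using that by (simp add: F''_def wjoin split: if_splits)
    ultimately show "prime_filter F''"
      unfolding prime_filter_def lattice_filter_def by (auto simp: F''_def wbot wtop)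
  qed
qed

text \<open>Induction over the generators collects those that occur in \<open>a\<close>. The sets of
  two elements are merged by union; both constants are put in from the start, and
  \<open>determined_imp\<close> relies on \<open>\<top>\<close>.\<close>

lemma free_finitely_determined:
  assumes free: "free_goedel_algebra TYPE('a + nat) L S q" and a: "a \<in> carrier L"
  obtains T where "finite T" "\<bottom> \<in> T" "\<top> \<in> T" "T \<subseteq> insert \<bottom> (insert \<top> (q ` S))" "determined T a"
proof -
  have qL: "insert \<bottom> (insert \<top> (q ` S)) \<subseteq> carrier L"
    using free by (auto simp: free_goedel_algebra_def)
  define P where "P = (\<lambda>a. \<exists>T. finite T \<and> \<bottom> \<in> T \<and> \<top> \<in> T \<and>
    T \<subseteq> insert \<bottom> (insert \<top> (q ` S)) \<and> determined T a)"
  have atom: "P t" if "t \<in> insert \<bottom> (insert \<top> (q ` S))" for t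
    unfolding P_def using that qL
    by (intro exI[of _ "{t, \<bottom>, \<top>}"]) (auto intro!: determined_self)
  have common: "\<exists>T. finite T \<and> \<bottom> \<in> T \<and> \<top> \<in> T \<and> T \<subseteq> insert \<bottom> (insert \<top> (q ` S)) \<and>
      T \<subseteq> carrier L \<and> determined T x \<and> determined T y" if xy: "P x" "P y" for x y
  proof -
    obtain T U where T: "finite T" "\<bottom> \<in> T" "\<top> \<in> T" "T \<subseteq> insert \<bottom> (insert \<top> (q ` S))" "determined T x"
      and U: "finite U" "\<bottom> \<in> U" "\<top> \<in> U" "U \<subseteq> insert \<bottom> (insert \<top> (q ` S))" "determined U y"
      using xy unfolding P_def by blast
    moreover have "determined (T \<union> U) x" "determined (T \<union> U) y"
      using determined_mono[OF T(5)] determined_mono[OF U(5)] by auto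
    moreover have "T \<union> U \<subseteq> carrier L"
      using T(4) U(4) qL by blast
    ultimately show ?thesis
      by (intro exI[of _ "T \<union> U"]) simp
  qed
  have "P a"
    using free a
  proof (rule free_generated)
    fix x y
    assume c: "x \<in> carrier L" "y \<in> carrier L" and p: "P x" "P y"
    obtain T where T: "finite T" "\<bottom> \<in> T" "\<top> \<in> T" "T \<subseteq> insert \<bottom> (insert \<top> (q ` S))" "T \<subseteq> carrier L"
      "determined T x" "determined T y"
      using common[OF p] by blast
    show "P (x \<sqinter> y)"
      unfolding P_def using T determined_meet[OF T(6) c(1) T(7) c(2) T(5)] by blast
    show "P (x \<squnion> y)"
      unfolding P_def using T determined_join[OF T(6) c(1) T(7) c(2) T(5)] by blast
    show "P (x \<rightharpoonup> y)"
      unfolding P_def using T determined_imp[OF T(6) c(1) T(7) c(2) T(5,3)] by blast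
  qed (simp_all add: atom)
  then show thesis
    using that unfolding P_def by blast
qed

lemma free_difference_exists:
  assumes free: "free_goedel_algebra TYPE('a + nat) L S q"
    and a: "a \<in> carrier L" and b: "b \<in> carrier L"
  shows "\<exists>c. least L c {d \<in> carrier L. a \<sqsubseteq> b \<squnion> d}"
proof -
  obtain Ta where Ta: "finite Ta" "\<bottom> \<in> Ta" "\<top> \<in> Ta" "Ta \<subseteq> insert \<bottom> (insert \<top> (q ` S))" "determined Ta a"
    using free_finitely_determined[OF free a] by metis
  obtain Tb where Tb: "finite Tb" "\<bottom> \<in> Tb" "\<top> \<in> Tb" "Tb \<subseteq> insert \<bottom> (insert \<top> (q ` S))" "determined Tb b"
    using free_finitely_determined[OF free b] by metis
  define T where "T = Ta \<union> Tb"
  have T: "finite T" "T \<subseteq> insert \<bottom> (insert \<top> (q ` S))" "\<top> \<in> T"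
    and det: "determined T a" "determined T b"
    using Ta Tb determined_mono by (auto simp: T_def)
  have "insert \<bottom> (insert \<top> (q ` S)) \<subseteq> carrier L"
    using free by (auto simp: free_goedel_algebra_def)
  with T(2) have TL: "T \<subseteq> carrier L"
    by blast
  obtain J where JL: "\<And>R. J R \<in> carrier L"
    and J: "\<And>R F. prime_filter F \<Longrightarrow> J R \<in> F \<longleftrightarrow>
      (\<forall>x\<in>T. \<forall>y\<in>T. if (x, y) \<in> R then x \<rightharpoonup> y \<in> F else x \<rightharpoonup> y \<in> F \<longrightarrow> y \<in> F)"
    using collapse_formula_exists[OF T(1) TL] by blast
  define R where "R F = {(x, y) \<in> T \<times> T. x \<rightharpoonup> y \<in> F}" for F
  have JR: "J (R F) \<in> F' \<longleftrightarrow> collapses T F F'" if "prime_filter F'" for F F'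
    using J[OF that, of "R F"] unfolding collapses_def R_def by (simp cong: ball_cong)
  define D where "D = {J (R F) |F. prime_filter F \<and> a \<in> F \<and> b \<notin> F}"
  \<comment> \<open>There may be infinitely many \<open>F\<close>, but \<open>J (R F)\<close>
    depends only on the trace of the order of \<open>F\<close> on the finite set
    \<open>T\<close>.\<close>
  have "D \<subseteq> J ` Pow (T \<times> T)"
    by (auto simp: D_def R_def)
  then have "finite D"
    by (rule finite_subset) (simp add: T(1))
  moreover have "D \<subseteq> carrier L"
    using JL by (auto simp: D_def)
  ultimately obtain c where cL: "c \<in> carrier L"
    and c: "\<And>z. z \<in> carrier L \<Longrightarrow> c \<sqsubseteq> z \<longleftrightarrow> (\<forall>x\<in>D. x \<sqsubseteq> z)"
    using finite_join_exists by meson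
  \<comment> \<open>A prime filter \<open>F\<close> refuting the inequality collapses to itself, so
    it contains its own \<open>J (R F)\<close>, one of the elements joined in
    \<open>c\<close>.\<close>
  have le: "a \<sqsubseteq> b \<squnion> c"
  proof (rule ccontr)
    assume "\<not> a \<sqsubseteq> b \<squnion> c"
    then obtain F where F: "prime_filter F" "a \<in> F" "b \<squnion> c \<notin> F"
      using prime_filter_separates[OF a, of "b \<squnion> c"] b cL by auto
    then have nF: "b \<notin> F" "c \<notin> F"
      using prime_filter_join_iff[OF F(1) b cL] by auto
    have "J (R F) \<in> F"
      using JR[OF F(1)] collapses_refl by simp
    moreover have "J (R F) \<sqsubseteq> c"
      using F nF c[OF cL] cL by (auto simp: D_def)
    ultimately show False
      using prime_filter_upward[OF F(1)] cL nF by blast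
  qed
  have "c \<sqsubseteq> d" if dL: "d \<in> carrier L" and d: "a \<sqsubseteq> b \<squnion> d" for d
  proof -
    have "J (R F) \<sqsubseteq> d" if F: "prime_filter F" "a \<in> F" "b \<notin> F" for F
    proof (rule ccontr)
      assume "\<not> J (R F) \<sqsubseteq> d"
      then obtain F' where F': "prime_filter F'" "J (R F) \<in> F'" "d \<notin> F'"
        using prime_filter_separates[OF JL dL] by blast
      then have col: "collapses T F F'"
        using JR by blast
      obtain F'' where F'': "prime_filter F''" "F'' \<subseteq> F'"
        and same: "\<And>x y. \<lbrakk>x \<in> T; y \<in> T\<rbrakk> \<Longrightarrow> x \<rightharpoonup> y \<in> F'' \<longleftrightarrow> x \<rightharpoonup> y \<in> F"
        using free_lift_collapse[OF free T(1,2) F(1) F'(1) col] by metis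
      \<comment> \<open>Equal orders on \<open>T\<close> are collapses of each other. One direction
        carries \<open>a\<close> from \<open>F\<close> to \<open>F''\<close>; the other would carry
        \<open>b\<close> from \<open>F''\<close> back to \<open>F\<close>.\<close>
      have "collapses T F F''" "collapses T F'' F"
        using same by (simp_all add: collapses_def)
      then have "a \<in> F''" "b \<notin> F''"
        using determined_mem_collapse[OF det(1) a TL T(3) F(1) F''(1)]
          determined_mem_collapse[OF det(2) b TL T(3) F''(1) F(1)] F by blast+
      moreover have "d \<notin> F''"
        using F'' F'(3) by blast
      ultimately show False
        using prime_filter_upward[OF F''(1) _ d] prime_filter_join_iff[OF F''(1) b dL] b dL by simp
    qed
    then show ?thesis
      using c[OF dL] by (auto simp: D_def)
  qed
  then have "least L c {d \<in> carrier L. a \<sqsubseteq> b \<squnion> d}"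
    using le cL by (auto simp: least_def)
  then show ?thesis ..
qed

end

theorem theorem5p10:
  fixes G :: "'a gorder" and S :: "'s set" and q :: "'s \<Rightarrow> 'a"
  assumes "free_goedel_algebra TYPE('a + nat) G S q"
  shows "bi_heyting_algebra G"
proof -
  interpret goedel_algebra G
    using assms by (simp add: free_goedel_algebra_def)
  show ?thesis
    by (intro bi_heyting_algebra.intro bi_heyting_algebra_axioms.intro heyting_algebra_axioms
        dual_heyting_algebraI free_difference_exists[OF assms])
qed

end
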